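(* Let $\mathcal M$ be the algebra of complex $q\times q$ matrices and $\mathcal A=\bigotimes_{\mathbb N}\mathcal M$. Let $n\in\mathbb N$ and let $E_{[n+1,n]}:\mathcal A_{[n,n+1]}\to\mathcal A_{\{n\}}$ be a completely positive linear map. Then the formula $$a\otimes b\mapsto a\otimes E_{[n+1,n]}(b),\qquad a\in\mathcal A_{n-1]},\ b\in\mathcal A_{[n,n+1]},$$ determines a unique quasi-conditional expectation $\widetilde E_{n]}$ with respect to the triplet $\mathcal A_{n-1]}\subseteq\mathcal A_{n]}\subseteq\mathcal A_{n+1]}$.
   Context: $\mathcal A=\bigotimes_{\mathbb N}\mathcal M$ is the infinite tensor product of copies of $\mathcal M$ indexed by $\mathbb N=\{0,1,2,\dots\}$; $j_k:\mathcal M\to\mathcal A$ is the natural immersion onto the $k$-th factor. $\mathcal A_{[m,n]}$ is the $C^*$-subalgebra of $\mathcal A$ spanned (i.e. generated) by $\bigcup_{k=m}^n j_k(\mathcal M)$; $\mathcal A_{\{n\}}=j_n(\mathcal M)$, $\mathcal A_{n]}=\mathcal A_{[0,n]}$, $\mathcal A_{-1]}=\mathbb C1$; thus $\mathcal A_{n+1]}=\mathcal A_{n-1]}\otimes\mathcal A_{[n,n+1]}$ and $\mathcal A_{n]}=\mathcal A_{n-1]}\otimes\mathcal A_{\{n\}}$. A linear map $P:\mathcal D\to\mathcal B$ between $*$-algebras is completely positive if $\sum_{j,k=1}^m b_j^*P(d_j^*d_k)b_k\ge0$ for all $m\ge1$, $b_j\in\mathcal B$, $d_j\in\mathcal D$.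 For unital $*$-algebras $\mathcal C\subseteq\mathcal B\subseteq\mathcal D$, a quasi-conditional expectation with respect to this triplet is a completely positive linear $*$-map $E:\mathcal D\to\mathcal B$ with $E(1)=1$ and $E(ca)=cE(a)$ for all $a\in\mathcal D$, $c\in\mathcal C$; a map with the same properties except that $E(1)\ne1$ is called a non-normalized quasi-conditional expectation.
   Formalization: The extension sends 1 to E_{[n+1,n]}(1), so it cannot be normalized unless E_{[n+1,n]}(1)=1 (e.g. E=0); the formal theorem gives a unique quasi-conditional expectation if E_{[n+1,n]}(1)=1 and a unique non-normalized one otherwise. *)

theory Defs
  imports "HOL-Analysis.Analysis"
begin

section \<open>Complex *-algebras\<close>

class scaleC =
  fixes scaleC :: "complex \<Rightarrow> 'a \<Rightarrow> 'a"  (infixr \<open>*\<^sub>C\<close> 75)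

class star_algebra_1 = ring_1 + scaleC +
  fixes star :: "'a \<Rightarrow> 'a"
  assumes scaleC_add_right: "c *\<^sub>C (x + y) = c *\<^sub>C x + c *\<^sub>C y"
    and scaleC_add_left: "(c + d) *\<^sub>C x = c *\<^sub>C x + d *\<^sub>C x"
    and scaleC_scaleC: "c *\<^sub>C d *\<^sub>C x = (c * d) *\<^sub>C x"
    and scaleC_one: "1 *\<^sub>C x = x"
    and mult_scaleC_left: "(c *\<^sub>C x) * y = c *\<^sub>C (x * y)"
    and mult_scaleC_right: "x * (c *\<^sub>C y) = c *\<^sub>C (x * y)"
    and star_star: "star (star x) = x"
    and star_add: "star (x + y) = star x + star y"
    and star_scaleC: "star (c *\<^sub>C x) = cnj c *\<^sub>C star x"
    and star_mult: "star (x * y) = star y * star x"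

definition star_subalgebra :: "'a::star_algebra_1 set \<Rightarrow> bool" where
  "star_subalgebra B \<longleftrightarrow> 0 \<in> B \<and>
     (\<forall>x\<in>B. \<forall>y\<in>B. x + y \<in> B \<and> x * y \<in> B) \<and>
     (\<forall>c. \<forall>x\<in>B. c *\<^sub>C x \<in> B) \<and> (\<forall>x\<in>B. star x \<in> B)"

definition clinear_map :: "'a::star_algebra_1 set \<Rightarrow> 'b::star_algebra_1 set \<Rightarrow> ('a \<Rightarrow> 'b) \<Rightarrow> bool" where
  "clinear_map D B P \<longleftrightarrow> P \<in> D \<rightarrow> B \<and>
     (\<forall>x\<in>D. \<forall>y\<in>D. P (x + y) = P x + P y) \<and> (\<forall>c. \<forall>x\<in>D. P (c *\<^sub>C x) = c *\<^sub>C P x)"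

text \<open>The order of a *-algebra: its positive elements are the finite sums of squares
  \<open>star c * c\<close>.  In a C*-algebra a single square suffices, so that this is the
  usual cone there.\<close>

definition positive_in :: "'b::star_algebra_1 set \<Rightarrow> 'b \<Rightarrow> bool" where
  "positive_in B x \<longleftrightarrow> (\<exists>(N::nat) c. (\<forall>i<N. c i \<in> B) \<and> x = (\<Sum>i<N. star (c i) * c i))"

definition completely_positive ::
    "'a::star_algebra_1 set \<Rightarrow> 'b::star_algebra_1 set \<Rightarrow> ('a \<Rightarrow> 'b) \<Rightarrow> bool" where
  "completely_positive D B P \<longleftrightarrow> clinear_map D B P \<and>
     (\<forall>m::nat. m \<ge> 1 \<longrightarrow> (\<forall>b d. (\<forall>j<m. b j \<in> B \<and> d j \<in> D) \<longrightarrow>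
        positive_in B (\<Sum>j<m. \<Sum>k<m. star (b j) * P (star (d j) * d k) * b k)))"

definition star_algebra_triplet :: "'a::star_algebra_1 set \<Rightarrow> 'a set \<Rightarrow> 'a set \<Rightarrow> bool" where
  "star_algebra_triplet C B D \<longleftrightarrow>
     star_subalgebra C \<and> star_subalgebra B \<and> star_subalgebra D \<and> 1 \<in> C \<and> C \<subseteq> B \<and> B \<subseteq> D"

text \<open>The properties of a quasi-conditional expectation other than the normalization.\<close>

definition quasi_cond_exp_axioms ::
    "'a::star_algebra_1 set \<Rightarrow> 'a set \<Rightarrow> 'a set \<Rightarrow> ('a \<Rightarrow> 'a) \<Rightarrow> bool" where
  "quasi_cond_exp_axioms C B D E \<longleftrightarrow>
     star_algebra_triplet C B D \<and> completely_positive D B E \<and>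
     (\<forall>x\<in>D. E (star x) = star (E x)) \<and> (\<forall>a\<in>D. \<forall>c\<in>C. E (c * a) = c * E a)"

definition quasi_cond_exp ::
    "'a::star_algebra_1 set \<Rightarrow> 'a set \<Rightarrow> 'a set \<Rightarrow> ('a \<Rightarrow> 'a) \<Rightarrow> bool" where
  "quasi_cond_exp C B D E \<longleftrightarrow> quasi_cond_exp_axioms C B D E \<and> E 1 = 1"

definition nonnormalized_quasi_cond_exp ::
    "'a::star_algebra_1 set \<Rightarrow> 'a set \<Rightarrow> 'a set \<Rightarrow> ('a \<Rightarrow> 'a) \<Rightarrow> bool" where
  "nonnormalized_quasi_cond_exp C B D E \<longleftrightarrow> quasi_cond_exp_axioms C B D E \<and> E 1 \<noteq> 1"


section \<open>Square-summable families\<close>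

typedef 'i ell2 = "{f :: 'i \<Rightarrow> complex. (\<lambda>i. (cmod (f i))\<^sup>2) summable_on UNIV}"
  by (rule exI[of _ "\<lambda>_. 0"]) simp

setup_lifting type_definition_ell2

lemma ell2_product_summable:
  fixes f g :: "'i \<Rightarrow> complex"
  assumes "(\<lambda>i. (cmod (f i))\<^sup>2) summable_on UNIV" "(\<lambda>i. (cmod (g i))\<^sup>2) summable_on UNIV"
  shows "(\<lambda>i. cnj (f i) * g i) summable_on UNIV"
proof -
  have "(\<lambda>i. norm (cnj (f i) * g i)) summable_on UNIV"
    by (rule abs_summable_product) (use assms in \<open>simp_all add: norm_mult power2_eq_square\<close>)
  thus ?thesis by (rule abs_summable_summable)
qed

lemma ell2_add_summable:
  fixes f g :: "'i \<Rightarrow> complex"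
  assumes "(\<lambda>i. (cmod (f i))\<^sup>2) summable_on UNIV" "(\<lambda>i. (cmod (g i))\<^sup>2) summable_on UNIV"
  shows "(\<lambda>i. (cmod (f i + g i))\<^sup>2) summable_on UNIV"
proof (rule summable_on_comparison_test)
  show "(\<lambda>i. 2 * (cmod (f i))\<^sup>2 + 2 * (cmod (g i))\<^sup>2) summable_on UNIV"
    by (intro summable_on_add summable_on_cmult_right assms)
  fix i
  have "(cmod (f i + g i))\<^sup>2 \<le> (cmod (f i) + cmod (g i))\<^sup>2"
    by (intro power_mono norm_triangle_ineq) simp
  also have "\<dots> \<le> 2 * (cmod (f i))\<^sup>2 + 2 * (cmod (g i))\<^sup>2"
    using sum_squares_bound[of "cmod (f i)" "cmod (g i)"] by (simp add: power2_sum)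
  finally show "(cmod (f i + g i))\<^sup>2 \<le> 2 * (cmod (f i))\<^sup>2 + 2 * (cmod (g i))\<^sup>2" .
qed auto

lemma ell2_scale_summable:
  fixes f :: "'i \<Rightarrow> complex"
  assumes "(\<lambda>i. (cmod (f i))\<^sup>2) summable_on UNIV"
  shows "(\<lambda>i. (cmod (c * f i))\<^sup>2) summable_on UNIV"
  using summable_on_cmult_right[OF assms, of "(cmod c)\<^sup>2"] by (simp add: norm_mult power_mult_distrib)

instantiation ell2 :: (type) real_vector
begin
lift_definition zero_ell2 :: "'a ell2" is "\<lambda>_. 0" by simp
lift_definition plus_ell2 :: "'a ell2 \<Rightarrow> 'a ell2 \<Rightarrow> 'a ell2" is "\<lambda>f g i. f i + g i"
  by (rule ell2_add_summable)
lift_definition uminus_ell2 :: "'a ell2 \<Rightarrow> 'a ell2" is "\<lambda>f i. - f i" by simp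
lift_definition minus_ell2 :: "'a ell2 \<Rightarrow> 'a ell2 \<Rightarrow> 'a ell2" is "\<lambda>f g i. f i - g i"
  subgoal for f g using ell2_add_summable[of f "\<lambda>i. - g i"] by simp
  done
lift_definition scaleR_ell2 :: "real \<Rightarrow> 'a ell2 \<Rightarrow> 'a ell2" is "\<lambda>r f i. of_real r * f i"
  by (rule ell2_scale_summable)
instance
  by standard (transfer; simp add: algebra_simps)+
end

lift_definition cinner :: "'i ell2 \<Rightarrow> 'i ell2 \<Rightarrow> complex" is "\<lambda>f g. \<Sum>\<^sub>\<infinity>i. cnj (f i) * g i" .

lemma cinner_add_left: "cinner (x + y) z = cinner x z + cinner y z"
  by transfer (simp add: distrib_right infsum_add ell2_product_summable)

lemma cinner_commute: "cinner x y = cnj (cinner y x)"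
  by transfer (simp flip: infsum_cnj add: mult.commute)

lemma cinner_add_right: "cinner x (y + z) = cinner x y + cinner x z"
  by (metis cinner_add_left cinner_commute complex_cnj_add)

lemma cinner_self: "cinner x x = of_real (\<Sum>\<^sub>\<infinity>i. (cmod (Rep_ell2 x i))\<^sup>2)"
proof -
  have "((\<lambda>i. of_real ((cmod (Rep_ell2 x i))\<^sup>2) :: complex) has_sum
      of_real (\<Sum>\<^sub>\<infinity>i. (cmod (Rep_ell2 x i))\<^sup>2)) UNIV"
    by (intro has_sum_of_real has_sum_infsum) (use Rep_ell2[of x] in simp)
  moreover have "of_real ((cmod (Rep_ell2 x i))\<^sup>2) = cnj (Rep_ell2 x i) * Rep_ell2 x i" for i
    by (simp add: complex_norm_square mult.commute del: of_real_power)
  ultimately show ?thesis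
    by (simp only: cinner.rep_eq infsumI)
qed

instantiation ell2 :: (type) real_inner
begin
definition "inner_ell2 (x :: 'a ell2) y = Re (cinner x y)"
definition "norm_ell2 (x :: 'a ell2) = sqrt (inner x x)"
definition "sgn_ell2 (x :: 'a ell2) = x /\<^sub>R norm x"
definition "dist_ell2 (x :: 'a ell2) y = norm (x - y)"
definition [code del]:
  "(uniformity :: ('a ell2 \<times> 'a ell2) filter) = (INF e\<in>{0 <..}. principal {(x, y). dist x y < e})"
definition [code del]:
  "open (U :: 'a ell2 set) \<longleftrightarrow> (\<forall>x\<in>U. eventually (\<lambda>(x', y). x' = x \<longrightarrow> y \<in> U) uniformity)"
instance
proof
  fix x y z :: "'a ell2" and r :: real
  show "inner x y = inner y x"
    unfolding inner_ell2_def by (subst cinner_commute) simp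
  show "inner (x + y) z = inner x z + inner y z"
    by (simp add: inner_ell2_def cinner_add_left)
  show "inner (r *\<^sub>R x) y = r * inner x y"
    unfolding inner_ell2_def by transfer (simp add: mult.assoc infsum_cmult_right ell2_product_summable)
  show "0 \<le> inner x x"
    by (simp add: inner_ell2_def cinner_self infsum_nonneg)
  show "inner x x = 0 \<longleftrightarrow> x = 0"
  proof
    assume "inner x x = 0"
    hence *: "(\<Sum>\<^sub>\<infinity>i. (cmod (Rep_ell2 x i))\<^sup>2) = 0"
      by (simp add: inner_ell2_def cinner_self)
    have "(cmod (Rep_ell2 x i))\<^sup>2 = 0" for i
      by (rule nonneg_infsum_le_0D[where A = UNIV]) (use * Rep_ell2[of x] in auto)
    thus "x = 0"
      by transfer auto
  next
    assume "x = 0"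
    thus "inner x x = 0" by (simp add: inner_ell2_def cinner_self zero_ell2.rep_eq)
  qed
qed (rule norm_ell2_def sgn_ell2_def dist_ell2_def uniformity_ell2_def open_ell2_def)+
end

lemma cinner_self_norm: "cinner x x = of_real ((norm x)\<^sup>2)"
  by (simp add: norm_ell2_def inner_ell2_def cinner_self infsum_nonneg)

lemma norm_ell2_sq: "(norm x)\<^sup>2 = (\<Sum>\<^sub>\<infinity>i. (cmod (Rep_ell2 x i))\<^sup>2)"
  using cinner_self_norm[of x] cinner_self[of x] of_real_eq_iff by metis

lift_definition scaleC_ell2 :: "complex \<Rightarrow> 'i ell2 \<Rightarrow> 'i ell2" is "\<lambda>c f i. c * f i"
  by (rule ell2_scale_summable)

lemma cinner_scaleC_right: "cinner x (scaleC_ell2 c y) = c * cinner x y"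
  by transfer (simp add: mult.left_commute infsum_cmult_right ell2_product_summable)

lemma cinner_scaleC_left: "cinner (scaleC_ell2 c x) y = cnj c * cinner x y"
  by transfer (simp add: mult.assoc infsum_cmult_right ell2_product_summable)

lemma bounded_linear_scaleC_ell2: "bounded_linear (scaleC_ell2 c)"
proof (rule bounded_linear_intro)
  fix x y :: "'i ell2" and r :: real
  show "scaleC_ell2 c (x + y) = scaleC_ell2 c x + scaleC_ell2 c y"
    by transfer (simp add: algebra_simps)
  show "scaleC_ell2 c (r *\<^sub>R x) = r *\<^sub>R scaleC_ell2 c x"
    by transfer (simp add: algebra_simps)
  have "(norm (scaleC_ell2 c x))\<^sup>2 = (norm x * cmod c)\<^sup>2"
    unfolding norm_ell2_sq
    by (simp add: scaleC_ell2.rep_eq norm_mult power_mult_distrib infsum_cmult_right' mult.commute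
        norm_ell2_sq)
  thus "norm (scaleC_ell2 c x) \<le> norm x * cmod c"
    by (simp add: power2_eq_iff_nonneg)
qed

lemma cinner_eqI:
  assumes "\<And>z. cinner z x = cinner z y"
  shows "x = y"
proof -
  have "inner (x - y) x = inner (x - y) y"
    using assms by (simp add: inner_ell2_def)
  hence "inner (x - y) (x - y) = 0" by (simp add: inner_diff_right)
  thus ?thesis by simp
qed


lemma scaleR_ell2_eq: "r *\<^sub>R (x :: 'i ell2) = scaleC_ell2 (of_real r) x"
  by transfer simp

lemma cinner_simps:
  "cinner (- x) y = - cinner x y" "cinner x (- y) = - cinner x y"
  "cinner (x - z) y = cinner x y - cinner z y" "cinner y (x - z) = cinner y x - cinner y z"
  "cinner 0 y = 0" "cinner y 0 = 0"
proof -
  show zero: "cinner 0 y = 0" "cinner y 0 = 0" for y :: "'a ell2"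
    by (transfer; simp)+
  show uminus: "cinner (- x) y = - cinner x y" "cinner y (- x) = - cinner y x" for x y :: "'a ell2"
    using cinner_add_left[of x "- x" y] cinner_add_right[of y x "- x"] zero
    by (simp_all add: add_eq_0_iff)
  show "cinner (x - z) y = cinner x y - cinner z y" "cinner y (x - z) = cinner y x - cinner y z"
    using cinner_add_left[of x "- z" y] cinner_add_right[of y x "- z"] by (simp_all add: uminus)
qed

lemma scaleC_ell2_simps:
  "scaleC_ell2 c (x + y) = scaleC_ell2 c x + scaleC_ell2 c y"
  "scaleC_ell2 (c + d) x = scaleC_ell2 c x + scaleC_ell2 d x"
  "scaleC_ell2 c (scaleC_ell2 d x) = scaleC_ell2 (c * d) x"
  "scaleC_ell2 1 x = x"
  by (transfer; simp add: algebra_simps)+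

lemma ell2_restrict_shift:
  fixes f :: "(nat \<Rightarrow> 'q) \<Rightarrow> complex" and k :: nat and a b :: 'q
  assumes "(\<lambda>\<sigma>. (cmod (f \<sigma>))\<^sup>2) summable_on UNIV"
  defines "g \<equiv> (\<lambda>\<sigma>. if \<sigma> k = a then f (\<sigma>(k := b)) else 0)"
  shows "(\<lambda>\<sigma>. (cmod (g \<sigma>))\<^sup>2) summable_on UNIV"
    and "(\<Sum>\<^sub>\<infinity>\<sigma>. (cmod (g \<sigma>))\<^sup>2) \<le> (\<Sum>\<^sub>\<infinity>\<sigma>. (cmod (f \<sigma>))\<^sup>2)"
proof -
  let ?A = "{\<sigma> :: nat \<Rightarrow> 'q. \<sigma> k = a}" and ?B = "{\<sigma> :: nat \<Rightarrow> 'q. \<sigma> k = b}"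
  have bij: "bij_betw (\<lambda>\<sigma>. \<sigma>(k := b)) ?A ?B"
    by (rule bij_betwI[where g = "\<lambda>\<sigma>. \<sigma>(k := a)"]) auto
  have fB: "(\<lambda>\<sigma>. (cmod (f \<sigma>))\<^sup>2) summable_on ?B"
    using assms(1) by (rule summable_on_subset) auto
  hence "(\<lambda>\<sigma>. (cmod (f (\<sigma>(k := b))))\<^sup>2) summable_on ?A"
    using summable_on_reindex_bij_betw[OF bij, of "\<lambda>\<sigma>. (cmod (f \<sigma>))\<^sup>2"] by simp
  thus "(\<lambda>\<sigma>. (cmod (g \<sigma>))\<^sup>2) summable_on UNIV"
    by (rule summable_on_cong_neutral[THEN iffD1, rotated -1]) (auto simp: g_def)
  have "(\<Sum>\<^sub>\<infinity>\<sigma>. (cmod (g \<sigma>))\<^sup>2) = (\<Sum>\<^sub>\<infinity>\<sigma>\<in>?A. (cmod (f (\<sigma>(k := b))))\<^sup>2)"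
    by (rule infsum_cong_neutral) (auto simp: g_def)
  also have "\<dots> = (\<Sum>\<^sub>\<infinity>\<sigma>\<in>?B. (cmod (f \<sigma>))\<^sup>2)"
    using infsum_reindex_bij_betw[OF bij, of "\<lambda>\<sigma>. (cmod (f \<sigma>))\<^sup>2"] by simp
  also have "\<dots> \<le> (\<Sum>\<^sub>\<infinity>\<sigma>. (cmod (f \<sigma>))\<^sup>2)"
    by (rule infsum_mono2) (use fB assms(1) in auto)
  finally show "(\<Sum>\<^sub>\<infinity>\<sigma>. (cmod (g \<sigma>))\<^sup>2) \<le> (\<Sum>\<^sub>\<infinity>\<sigma>. (cmod (f \<sigma>))\<^sup>2)" .
qed

lift_definition site_unit_ell2 :: "nat \<Rightarrow> 'q \<Rightarrow> 'q \<Rightarrow> (nat \<Rightarrow> 'q) ell2 \<Rightarrow> (nat \<Rightarrow> 'q) ell2"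
  is "\<lambda>k a b f \<sigma>. if \<sigma> k = a then f (\<sigma>(k := b)) else 0"
  by (rule ell2_restrict_shift)

lemma cinner_site_unit:
  "cinner (site_unit_ell2 k a b x) y = cinner x (site_unit_ell2 k b a y)"
proof -
  let ?A = "{\<sigma> :: nat \<Rightarrow> 'a. \<sigma> k = a}" and ?B = "{\<sigma> :: nat \<Rightarrow> 'a. \<sigma> k = b}"
  let ?f = "Rep_ell2 x" and ?g = "Rep_ell2 y"
  have bij: "bij_betw (\<lambda>\<sigma>. \<sigma>(k := b)) ?A ?B"
    by (rule bij_betwI[where g = "\<lambda>\<sigma>. \<sigma>(k := a)"]) auto
  have "cinner (site_unit_ell2 k a b x) y = (\<Sum>\<^sub>\<infinity>\<sigma>\<in>?A. cnj (?f (\<sigma>(k := b))) * ?g \<sigma>)"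
    unfolding cinner.rep_eq site_unit_ell2.rep_eq by (rule infsum_cong_neutral) auto
  also have "\<dots> = (\<Sum>\<^sub>\<infinity>\<sigma>\<in>?A. cnj (?f (\<sigma>(k := b))) * ?g ((\<sigma>(k := b))(k := a)))"
    by (rule infsum_cong) auto
  also have "\<dots> = (\<Sum>\<^sub>\<infinity>\<sigma>\<in>?B. cnj (?f \<sigma>) * ?g (\<sigma>(k := a)))"
    using infsum_reindex_bij_betw[OF bij, of "\<lambda>\<sigma>. cnj (?f \<sigma>) * ?g (\<sigma>(k := a))"] .
  also have "\<dots> = cinner x (site_unit_ell2 k b a y)"
    unfolding cinner.rep_eq site_unit_ell2.rep_eq by (rule infsum_cong_neutral) auto
  finally show ?thesis .
qed

lemma bounded_linear_site_unit_ell2: "bounded_linear (site_unit_ell2 k a b)"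
proof (rule bounded_linear_intro[where K = 1])
  fix x y :: "(nat \<Rightarrow> 'a) ell2" and r :: real
  show "site_unit_ell2 k a b (x + y) = site_unit_ell2 k a b x + site_unit_ell2 k a b y"
    by transfer auto
  show "site_unit_ell2 k a b (r *\<^sub>R x) = r *\<^sub>R site_unit_ell2 k a b x"
    by transfer auto
  have "(norm (site_unit_ell2 k a b x))\<^sup>2 \<le> (norm x)\<^sup>2"
    using ell2_restrict_shift(2)[of "Rep_ell2 x" k a b] Rep_ell2[of x]
    by (simp add: norm_ell2_sq site_unit_ell2.rep_eq)
  thus "norm (site_unit_ell2 k a b x) \<le> norm x * 1"
    by (simp add: power2_le_iff_abs_le)
qed

lifting_forget ell2.lifting


section \<open>Bounded operators\<close>

text \<open>The algebra of bounded complex-linear operators on \<open>'i ell2\<close>.  These are the bounded operators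
  possessing an adjoint: complex linearity follows from adjointability, and conversely, since
  \<open>'i ell2\<close> is a Hilbert space, every bounded complex-linear operator has an adjoint.\<close>

typedef 'i bop =
  "{T :: 'i ell2 \<Rightarrow>\<^sub>L 'i ell2. \<exists>S :: 'i ell2 \<Rightarrow>\<^sub>L 'i ell2. \<forall>x y. cinner (T x) y = cinner x (S y)}"
  by (rule exI[of _ id_blinfun], simp, rule exI[of _ id_blinfun], simp)

setup_lifting type_definition_bop

lemma adjoint_unique:
  fixes S S' :: "'i ell2 \<Rightarrow>\<^sub>L 'i ell2"
  assumes "\<forall>x y. cinner (T x) y = cinner x (S y)" "\<forall>x y. cinner (T x) y = cinner x (S' y)"
  shows "S = S'"
  by (intro blinfun_eqI cinner_eqI) (metis assms)

lemma the_adjoint: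
  fixes S :: "'i ell2 \<Rightarrow>\<^sub>L 'i ell2"
  assumes "\<forall>x y. cinner (T x) y = cinner x (S y)"
  shows "(THE S. \<forall>x y. cinner (T x) y = cinner x (blinfun_apply S y)) = S"
  using assms by (rule the_equality) (rule adjoint_unique[OF _ assms])

lift_definition bop_apply :: "'i bop \<Rightarrow> 'i ell2 \<Rightarrow> 'i ell2" is blinfun_apply .

lemma bop_eqI: "(\<And>v. bop_apply S v = bop_apply T v) \<Longrightarrow> S = T"
  by transfer (rule blinfun_eqI)

lemma cinner_adjoint_swap:
  assumes "\<forall>x y. cinner (T x) y = cinner x (S y)"
  shows "cinner (S x) y = cinner x (T y)"
  by (metis assms cinner_commute)

lift_definition scaleC_blinfun :: "complex \<Rightarrow> ('i ell2 \<Rightarrow>\<^sub>L 'i ell2) \<Rightarrow> ('i ell2 \<Rightarrow>\<^sub>L 'i ell2)"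
  is "\<lambda>c T x. scaleC_ell2 c (T x)"
  by (rule bounded_linear_compose[OF bounded_linear_scaleC_ell2])

instantiation bop :: (type) "{star_algebra_1, real_vector, norm}"
begin
lift_definition zero_bop :: "'a bop" is 0
  by (rule exI[of _ 0]) (simp add: cinner_simps)
lift_definition one_bop :: "'a bop" is id_blinfun
  by (rule exI[of _ id_blinfun]) simp
lift_definition plus_bop :: "'a bop \<Rightarrow> 'a bop \<Rightarrow> 'a bop" is "(+)"
  by (metis (no_types, lifting) cinner_add_left cinner_add_right plus_blinfun.rep_eq)
lift_definition uminus_bop :: "'a bop \<Rightarrow> 'a bop" is uminus
  by (metis (no_types, lifting) cinner_simps(1,2) uminus_blinfun.rep_eq)
lift_definition minus_bop :: "'a bop \<Rightarrow> 'a bop \<Rightarrow> 'a bop" is "(-)"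
  by (metis (no_types, lifting) cinner_simps(3,4) minus_blinfun.rep_eq)
lift_definition times_bop :: "'a bop \<Rightarrow> 'a bop \<Rightarrow> 'a bop" is "(o\<^sub>L)"
  by (metis (no_types, lifting) blinfun_apply_blinfun_compose)
lift_definition scaleC_bop :: "complex \<Rightarrow> 'a bop \<Rightarrow> 'a bop" is scaleC_blinfun
  subgoal for c T
    by (metis (no_types, lifting) cinner_scaleC_left cinner_scaleC_right complex_cnj_cnj scaleC_blinfun.rep_eq)
  done
lift_definition scaleR_bop :: "real \<Rightarrow> 'a bop \<Rightarrow> 'a bop" is "(*\<^sub>R)"
  subgoal for r T
    by (elim exE, rule_tac x = "r *\<^sub>R x" in exI)
      (simp add: scaleR_blinfun.rep_eq scaleR_ell2_eq cinner_scaleC_left cinner_scaleC_right)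
  done
lift_definition star_bop :: "'a bop \<Rightarrow> 'a bop"
  is "\<lambda>T. THE S. \<forall>x y. cinner (blinfun_apply T x) y = cinner x (blinfun_apply S y)"
  subgoal for T
  proof -
    assume "\<exists>S :: 'a ell2 \<Rightarrow>\<^sub>L 'a ell2. \<forall>x y. cinner (T x) y = cinner x (S y)"
    then obtain S :: "'a ell2 \<Rightarrow>\<^sub>L 'a ell2" where S: "\<forall>x y. cinner (T x) y = cinner x (S y)"
      by blast
    show ?thesis
      unfolding the_adjoint[OF S] using cinner_adjoint_swap[OF S] by metis
  qed
  done
lift_definition norm_bop :: "'a bop \<Rightarrow> real" is norm .

lemma bop_apply_simps:
  "bop_apply 0 v = 0" "bop_apply 1 v = v" "bop_apply (S + T) v = bop_apply S v + bop_apply T v"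
  "bop_apply (- T) v = - bop_apply T v" "bop_apply (S - T) v = bop_apply S v - bop_apply T v"
  "bop_apply (S * T) v = bop_apply S (bop_apply T v)"
  "bop_apply (c *\<^sub>C T) v = scaleC_ell2 c (bop_apply T v)"
  "bop_apply (r *\<^sub>R T) v = r *\<^sub>R bop_apply T v"
  by (transfer; simp add: blinfun.bilinear_simps scaleC_blinfun.rep_eq)+

lemma cinner_star: "cinner (bop_apply T x) y = cinner x (bop_apply (star T) y)"
proof transfer
  fix T :: "'a ell2 \<Rightarrow>\<^sub>L 'a ell2" and x y :: "'a ell2"
  assume "\<exists>S :: 'a ell2 \<Rightarrow>\<^sub>L 'a ell2. \<forall>x y. cinner (T x) y = cinner x (S y)"
  then obtain S :: "'a ell2 \<Rightarrow>\<^sub>L 'a ell2" where S: "\<forall>x y. cinner (T x) y = cinner x (S y)"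
    by blast
  show "cinner (T x) y = cinner x ((THE S. \<forall>x y. cinner (T x) y = cinner x (blinfun_apply S y)) y)"
    unfolding the_adjoint[OF S] using S by metis
qed

lemma star_bop_eqI:
  assumes "\<And>x y. cinner (bop_apply T x) y = cinner x (bop_apply S y)"
  shows "star T = (S :: 'a bop)"
  by (intro bop_eqI cinner_eqI) (metis assms cinner_star)

lemma bop_apply_linear:
  "bop_apply T (x + y) = bop_apply T x + bop_apply T y"
  "bop_apply T (x - y) = bop_apply T x - bop_apply T y"
  "bop_apply T (- x) = - bop_apply T x"
  "bop_apply T 0 = 0"
  "bop_apply T (r *\<^sub>R x) = r *\<^sub>R bop_apply T x"
  by (transfer; simp add: blinfun.bilinear_simps)+

lemma bop_apply_scaleC: "bop_apply (T :: 'a bop) (scaleC_ell2 c x) = scaleC_ell2 c (bop_apply T x)"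
proof (rule cinner_eqI)
  fix z
  have "cinner (bop_apply T (scaleC_ell2 c x)) z = cinner (scaleC_ell2 c (bop_apply T x)) z"
    by (simp add: cinner_star cinner_scaleC_left)
  thus "cinner z (bop_apply T (scaleC_ell2 c x)) = cinner z (scaleC_ell2 c (bop_apply T x))"
    by (metis cinner_commute)
qed

lemma cinner_star': "cinner x (bop_apply T y) = cinner (bop_apply (star T) x) y"
  by (metis cinner_star cinner_commute)

instance
proof
  fix x y z :: "'a bop" and c d :: complex and r s :: real
  show "x + y + z = x + (y + z)" "x + y = y + x" "0 + x = x" "- x + x = 0" "x - y = x + - y"
    by (transfer; simp)+
  show "x * y * z = x * (y * z)" "1 * x = x" "x * 1 = x"
    by (auto intro!: bop_eqI simp: bop_apply_simps)
  show "(x + y) * z = x * z + y * z" "x * (y + z) = x * y + x * z"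
    by (auto intro!: bop_eqI simp: bop_apply_simps bop_apply_linear)
  show "(0 :: 'a bop) \<noteq> 1"
  proof
    assume eq: "(0 :: 'a bop) = 1"
    have "(\<lambda>i::'a. (cmod (if i = undefined then 1 else 0))\<^sup>2) summable_on UNIV"
      by (rule finite_nonzero_values_imp_summable_on) (auto intro: finite_subset[of _ "{undefined}"])
    hence v: "Rep_ell2 (Abs_ell2 (\<lambda>i::'a. if i = undefined then 1 else 0)) undefined = 1"
      by (subst Abs_ell2_inverse) auto
    have "v = 0" for v :: "'a ell2"
      using bop_apply_simps(1)[of v] bop_apply_simps(2)[of v] eq by metis
    thus False using v by (metis zero_ell2.rep_eq zero_neq_one)
  qed
  show "c *\<^sub>C (x + y) = c *\<^sub>C x + c *\<^sub>C y" "(c + d) *\<^sub>C x = c *\<^sub>C x + d *\<^sub>C x"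
    "c *\<^sub>C d *\<^sub>C x = (c * d) *\<^sub>C x" "1 *\<^sub>C x = x"
    "(c *\<^sub>C x) * y = c *\<^sub>C (x * y)" "x * (c *\<^sub>C y) = c *\<^sub>C (x * y)"
    by (auto intro!: bop_eqI simp: bop_apply_simps bop_apply_linear scaleC_ell2_simps bop_apply_scaleC)
  show "star (star x) = x"
    by (rule star_bop_eqI) (simp add: cinner_star')
  show "star (x + y) = star x + star y"
    by (rule star_bop_eqI) (simp add: bop_apply_simps cinner_add_left cinner_add_right cinner_star)
  show "star (c *\<^sub>C x) = cnj c *\<^sub>C star x"
    by (rule star_bop_eqI) (simp add: bop_apply_simps cinner_scaleC_left cinner_scaleC_right cinner_star)
  show "star (x * y) = star y * star x"
    by (rule star_bop_eqI) (simp add: bop_apply_simps cinner_star)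
  show "r *\<^sub>R (x + y) = r *\<^sub>R x + r *\<^sub>R y" "(r + s) *\<^sub>R x = r *\<^sub>R x + s *\<^sub>R x"
    "r *\<^sub>R s *\<^sub>R x = (r * s) *\<^sub>R x" "1 *\<^sub>R x = x"
    by (auto intro!: bop_eqI simp: bop_apply_simps algebra_simps)
qed
end

text \<open>The topology on operators is that of the operator norm.\<close>

instantiation bop :: (type) real_normed_algebra_1
begin
definition "sgn_bop (x :: 'a bop) = x /\<^sub>R norm x"
definition "dist_bop (x :: 'a bop) y = norm (x - y)"
definition [code del]:
  "(uniformity :: ('a bop \<times> 'a bop) filter) = (INF e\<in>{0 <..}. principal {(x, y). dist x y < e})"
definition [code del]:
  "open (U :: 'a bop set) \<longleftrightarrow> (\<forall>x\<in>U. eventually (\<lambda>(x', y). x' = x \<longrightarrow> y \<in> U) uniformity)"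
instance
proof
  fix x y :: "'a bop" and r :: real
  show "(norm x = 0) = (x = 0)" "norm (r *\<^sub>R x) = \<bar>r\<bar> * norm x"
    by (transfer; simp)+
  show "norm (x + y) \<le> norm x + norm y"
    by transfer (rule norm_triangle_ineq)
  show mult: "norm (x * y) \<le> norm x * norm y" for x y :: "'a bop"
    by transfer (rule norm_blinfun_compose)
  show "r *\<^sub>R x * y = r *\<^sub>R (x * y)" "x * r *\<^sub>R y = r *\<^sub>R (x * y)"
    by (auto intro!: bop_eqI simp: bop_apply_simps bop_apply_linear)
  have "norm (1 :: 'a bop) \<noteq> 0"
    by (metis norm_eq_zero one_bop.rep_eq norm_bop.rep_eq zero_bop.rep_eq Rep_bop_inject zero_neq_one)
  moreover have "norm (1 :: 'a bop) \<ge> 0" by transfer simp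
  ultimately have "norm (1 :: 'a bop) \<ge> 1"
    using mult[of 1 1] by simp
  moreover have "norm (1 :: 'a bop) \<le> 1"
    by transfer (rule norm_blinfun_id_le)
  ultimately show "norm (1 :: 'a bop) = 1" by simp
qed (rule sgn_bop_def dist_bop_def uniformity_bop_def open_bop_def)+
end

lemma norm_bop_apply: "norm (bop_apply T v) \<le> norm T * norm v"
  by transfer (rule norm_blinfun)

lemma norm_bop_bound: "0 \<le> c \<Longrightarrow> (\<And>v. norm (bop_apply T v) \<le> c * norm v) \<Longrightarrow> norm T \<le> c"
  by transfer (rule norm_blinfun_bound)

lemma norm_star_mult_self: "norm (star T * T) = (norm (T :: 'i bop))\<^sup>2"
proof -
  have ge: "(norm T)\<^sup>2 \<le> norm (star T * T)" for T :: "'i bop"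
  proof -
    have "norm T \<le> sqrt (norm (star T * T))"
    proof (rule norm_bop_bound)
      fix v
      have "(norm (bop_apply T v))\<^sup>2 = inner (bop_apply T v) (bop_apply T v)"
        by (simp add: power2_norm_eq_inner)
      also have "\<dots> = inner v (bop_apply (star T * T) v)"
        by (simp add: inner_ell2_def bop_apply_simps cinner_star)
      also have "\<dots> \<le> norm v * norm (bop_apply (star T * T) v)"
        by (rule norm_cauchy_schwarz)
      also have "\<dots> \<le> norm v * (norm (star T * T) * norm v)"
        by (intro mult_left_mono norm_bop_apply) simp
      also have "\<dots> = (sqrt (norm (star T * T)) * norm v)\<^sup>2"
        by (simp add: power_mult_distrib) (simp add: power2_eq_square)
      finally show "norm (bop_apply T v) \<le> sqrt (norm (star T * T)) * norm v"
        by (rule power2_le_imp_le) simp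
    qed simp
    hence "(norm T)\<^sup>2 \<le> (sqrt (norm (star T * T)))\<^sup>2" by (rule power_mono) simp
    thus ?thesis by simp
  qed
  have le: "norm T \<le> norm (star T)" for T :: "'i bop"
  proof (cases "norm T = 0")
    case False
    have "norm T * norm T \<le> norm (star T) * norm T"
      using ge[of T] norm_mult_ineq[of "star T" T] by (simp add: power2_eq_square)
    thus ?thesis using False by (simp add: mult_le_cancel_right)
  qed (use norm_ge_zero[of "star T"] in linarith)
  have "norm (star T) = norm T"
    using le[of T] le[of "star T"] by (simp add: star_star)
  thus ?thesis
    using ge[of T] norm_mult_ineq[of "star T" T] by (simp add: power2_eq_square)
qed

text \<open>The C*-subalgebra generated by a set.\<close>

definition cstar_generated :: "'i bop set \<Rightarrow> 'i bop set" where
  "cstar_generated X = (\<lambda>S. star_subalgebra S \<and> closed S) hull X"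


section \<open>The infinite tensor product of matrix algebras\<close>

text \<open>The algebra of \<open>q \<times> q\<close> matrices is \<open>complex^'q^'q\<close> with \<open>q = CARD('q)\<close>.  The infinite
  C*-tensor product of copies of it is realized on the Hilbert space with orthonormal basis
  indexed by the configurations \<open>\<sigma> :: nat \<Rightarrow> 'q\<close>, which is the direct sum, over the
  tail-equivalence classes of configurations, of the corresponding incomplete infinite tensor
  products of \<open>complex^'q\<close>.  The operator \<open>site_unit k a b\<close> is the matrix unit \<open>e\<^sub>a\<^sub>b\<close> acting
  on the \<open>k\<close>-th coordinate: it maps the basis vector \<open>\<sigma>\<close> to \<open>\<sigma>(k := a)\<close> if \<open>\<sigma> k = b\<close>, and to 0
  otherwise.  Finite tensor products of matrix algebras are simple and have a unique C*-norm, so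
  that the C*-algebra generated by all sites is the C*-tensor product (the inductive
  limit of the finite ones).\<close>

type_synonym 'q chain_op = "(nat \<Rightarrow> 'q) bop"

lift_definition site_unit_blinfun :: "nat \<Rightarrow> 'q \<Rightarrow> 'q \<Rightarrow> (nat \<Rightarrow> 'q) ell2 \<Rightarrow>\<^sub>L (nat \<Rightarrow> 'q) ell2"
  is site_unit_ell2
  by (rule bounded_linear_site_unit_ell2)

lift_definition site_unit :: "nat \<Rightarrow> 'q \<Rightarrow> 'q \<Rightarrow> 'q chain_op" is site_unit_blinfun
  subgoal for k a b
    by (rule exI[of _ "site_unit_blinfun k b a"])
      (simp add: site_unit_blinfun.rep_eq cinner_site_unit)
  done

definition immersion :: "nat \<Rightarrow> complex^'q^'q \<Rightarrow> ('q::finite) chain_op" where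
  "immersion k x = (\<Sum>a\<in>UNIV. \<Sum>b\<in>UNIV. (x $ a $ b) *\<^sub>C site_unit k a b)"

lemma site_unit_apply: "bop_apply (site_unit k a b) v = site_unit_ell2 k a b v"
  by (simp add: bop_apply.rep_eq site_unit.rep_eq site_unit_blinfun.rep_eq)

lemma site_unit_mult: "site_unit k a b * site_unit k c d = (if b = c then site_unit k a d else 0)"
  by (rule bop_eqI, rule Rep_ell2_inject[THEN iffD1])
    (auto simp: bop_apply_simps site_unit_apply site_unit_ell2.rep_eq zero_ell2.rep_eq)

lemma site_unit_commute:
  "k \<noteq> l \<Longrightarrow> site_unit k a b * site_unit l c d = site_unit l c d * site_unit k a b"
  by (rule bop_eqI, rule Rep_ell2_inject[THEN iffD1])
    (auto simp: bop_apply_simps site_unit_apply site_unit_ell2.rep_eq fun_upd_twist[of k l])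

lemma star_site_unit: "star (site_unit k a b) = site_unit k b a"
  by (rule star_bop_eqI) (simp add: site_unit_apply cinner_site_unit)

lemma Rep_ell2_sum: "Rep_ell2 (\<Sum>i\<in>I. f i) \<sigma> = (\<Sum>i\<in>I. Rep_ell2 (f i) \<sigma>)"
  by (induction I rule: infinite_finite_induct) (auto simp: zero_ell2.rep_eq plus_ell2.rep_eq)

lemma bop_apply_sum: "bop_apply (\<Sum>i\<in>I. f i) v = (\<Sum>i\<in>I. bop_apply (f i) v)"
  by (induction I rule: infinite_finite_induct) (auto simp: bop_apply_simps)

lemma immersion_apply:
  "Rep_ell2 (bop_apply (immersion k x) v) \<sigma> = (\<Sum>b\<in>UNIV. x $ \<sigma> k $ b * Rep_ell2 v (\<sigma>(k := b)))"
proof -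
  have "Rep_ell2 (bop_apply (immersion k x) v) \<sigma> =
      (\<Sum>a\<in>UNIV. if a = \<sigma> k then \<Sum>b\<in>UNIV. x $ a $ b * Rep_ell2 v (\<sigma>(k := b)) else 0)"
    unfolding immersion_def bop_apply_sum Rep_ell2_sum bop_apply_simps site_unit_apply
      scaleC_ell2.rep_eq site_unit_ell2.rep_eq
    by (rule sum.cong) auto
  thus ?thesis by simp
qed

lemma immersion_eqI:
  "(\<And>v \<sigma>. Rep_ell2 (bop_apply S v) \<sigma> = Rep_ell2 (bop_apply T v) \<sigma>) \<Longrightarrow> S = T"
  by (rule bop_eqI, rule Rep_ell2_inject[THEN iffD1]) auto

lemma immersion_one: "immersion k (mat 1) = 1"
  by (rule immersion_eqI)
    (simp add: immersion_apply bop_apply_simps mat_def if_distrib[of "\<lambda>c. c * _"] cong: if_cong)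

lemma immersion_add: "immersion k (x + y) = immersion k x + immersion k y"
  by (rule immersion_eqI)
    (simp add: immersion_apply bop_apply_simps plus_ell2.rep_eq distrib_right sum.distrib)

lemma immersion_mult: "immersion k (x ** y) = immersion k x * immersion k y"
proof (rule immersion_eqI)
  fix v \<sigma>
  have "Rep_ell2 (bop_apply (immersion k (x ** y)) v) \<sigma> =
      (\<Sum>c\<in>UNIV. \<Sum>b\<in>UNIV. x $ \<sigma> k $ b * (y $ b $ c * Rep_ell2 v (\<sigma>(k := c))))"
    by (simp add: immersion_apply matrix_matrix_mult_def sum_distrib_right mult.assoc)
  also have "\<dots> = (\<Sum>b\<in>UNIV. \<Sum>c\<in>UNIV. x $ \<sigma> k $ b * (y $ b $ c * Rep_ell2 v (\<sigma>(k := c))))"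
    by (rule sum.swap)
  also have "\<dots> = Rep_ell2 (bop_apply (immersion k x * immersion k y) v) \<sigma>"
    by (simp add: immersion_apply bop_apply_simps sum_distrib_left)
  finally show "Rep_ell2 (bop_apply (immersion k (x ** y)) v) \<sigma> =
      Rep_ell2 (bop_apply (immersion k x * immersion k y) v) \<sigma>" .
qed

lemma immersion_scaleC: "immersion k (\<chi> a b. c * x $ a $ b) = c *\<^sub>C immersion k x"
  by (rule immersion_eqI)
    (simp add: immersion_apply bop_apply_simps scaleC_ell2.rep_eq sum_distrib_left mult.assoc)

lemma immersion_star: "star (immersion k x) = immersion k (\<chi> a b. cnj (x $ b $ a))"
proof -
  have star_sum: "star (\<Sum>i\<in>I. f i) = (\<Sum>i\<in>I. star (f i))" for I and f :: "'q \<Rightarrow> 'q chain_op"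
  proof (induction I rule: infinite_finite_induct)
    case empty
    show ?case using star_add[of 0 "0 :: 'q chain_op"] by simp
  next
    case (infinite A)
    thus ?case using star_add[of 0 "0 :: 'q chain_op"] by simp
  qed (simp add: star_add)
  show ?thesis
    unfolding immersion_def star_sum star_scaleC star_site_unit by (subst sum.swap, intro sum.cong) auto
qed

lemma immersion_commute:
  assumes "k \<noteq> l"
  shows "immersion k x * immersion l y = immersion l y * immersion k x"
proof (rule immersion_eqI)
  fix v \<sigma>
  have "Rep_ell2 (bop_apply (immersion k x * immersion l y) v) \<sigma> =
      (\<Sum>b\<in>UNIV. \<Sum>c\<in>UNIV. x $ \<sigma> k $ b * (y $ \<sigma> l $ c * Rep_ell2 v (\<sigma>(k := b, l := c))))"
    using assms by (simp add: immersion_apply bop_apply_simps sum_distrib_left)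
  also have "\<dots> = (\<Sum>c\<in>UNIV. \<Sum>b\<in>UNIV. x $ \<sigma> k $ b * (y $ \<sigma> l $ c * Rep_ell2 v (\<sigma>(k := b, l := c))))"
    by (rule sum.swap)
  also have "\<dots> = Rep_ell2 (bop_apply (immersion l y * immersion k x) v) \<sigma>"
    using assms
    by (simp add: immersion_apply bop_apply_simps sum_distrib_left mult.left_commute fun_upd_twist[of k l])
  finally show "Rep_ell2 (bop_apply (immersion k x * immersion l y) v) \<sigma> =
      Rep_ell2 (bop_apply (immersion l y * immersion k x) v) \<sigma>" .
qed

definition chain_algebra :: "('q::finite) chain_op set" where
  "chain_algebra = cstar_generated (\<Union>k. range (immersion k))"

definition segment_algebra :: "nat \<Rightarrow> nat \<Rightarrow> ('q::finite) chain_op set" where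
  "segment_algebra m n = cstar_generated (\<Union>k\<in>{m..n}. range (immersion k))"

definition site_algebra :: "nat \<Rightarrow> ('q::finite) chain_op set" where
  "site_algebra n = range (immersion n)"

definition initial_algebra :: "nat \<Rightarrow> ('q::finite) chain_op set" where
  "initial_algebra n = segment_algebra 0 n"

lemma segment_algebra_subset: "segment_algebra m n \<subseteq> chain_algebra"
  unfolding segment_algebra_def chain_algebra_def cstar_generated_def by (rule hull_mono) auto

text \<open>The algebra generated by the sites strictly before \<open>n\<close>; for \<open>n = 0\<close> it consists of the scalars.
  It commutes with \<open>segment_algebra n (n + 1)\<close>, and the elementary tensor \<open>a \<otimes> b\<close> of elements of
  these two algebras is the operator product \<open>a * b\<close>.\<close>

definition past_algebra :: "nat \<Rightarrow> ('q::finite) chain_op set" where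
  "past_algebra n = (if n = 0 then range (\<lambda>c. c *\<^sub>C 1) else initial_algebra (n - 1))"

end

(*
  Let e_st be the matrix units of the sites before n, and for an operator x let
  x_st = sum_u e_us x e_tu, so that x = sum_st e_st x_st.  An operator belongs to A_{n+1]} iff all
  its coefficients x_st belong to A_{[n,n+1]}, and the extension is x |-> sum_st e_st E(x_st).

  For complete positivity let T = sum_jk b_j* F(d_j* d_k) b_k.  It is a combination of the matrix
  units g of the sites 0, ..., n with scalar coefficients t, and for c = sum_i xi_i g_ip the product
  c* T c is <xi, t xi> g_pp.  Absorbing c into the b_j, the diagonal coefficients of c* T c are sums
  of expressions that the complete positivity of E makes positive.  Hence t is positive
  semidefinite, and a Gram factorization of t writes T as a sum of squares.
*)

theory Submission
  imports Defs
begin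

section \<open>Sums in *-algebras\<close>

text \<open>\<open>positive_in\<close> asks for explicit squares from the target algebra, so
  positivity in \<open>initial_algebra n\<close> needs witnesses there. The hypothesis on
  \<open>E\<close> yields only squares in \<open>site_algebra n\<close>, and only for diagonal
  coefficients; off-diagonal entries come under control because the compressing element runs over
  all columns \<open>\<xi>\<close>. The two kinds of squares are compared through quadratic forms on
  the Hilbert space: a sum of squares in \<open>site_algebra n\<close> that equals \<open>r\<close>
  times a nonzero projection forces \<open>r \<ge> 0\<close>. What remains concerns a scalar matrix,
  and there the Gram factorization supplies the witnesses by finite algebra, without square roots of
  operators. Norm closures cause no trouble: coefficients are finite sums of products, hence
  continuous, so closed conditions on coefficients define closed sets. That \<open>E\<close>
  respects \<open>star\<close> is not assumed; it follows from complete positivity by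
  polarization.\<close>

lemma scaleC_zero_left: "0 *\<^sub>C x = (0::'a::star_algebra_1)"
  using scaleC_add_left[of 0 0 x] by simp

lemma scaleC_zero_right: "c *\<^sub>C 0 = (0::'a::star_algebra_1)"
  using scaleC_add_right[of c 0 0] by simp

lemma scaleC_minus_one: "(-1) *\<^sub>C x = - (x::'a::star_algebra_1)"
  using scaleC_add_left[of "-1" 1 x] by (simp add: scaleC_zero_left scaleC_one eq_neg_iff_add_eq_0)

lemma scaleC_two: "2 *\<^sub>C x = x + (x::'a::star_algebra_1)"
  using scaleC_add_left[of 1 1 x] by (simp add: scaleC_one)

lemma scaleC_sum_right: "c *\<^sub>C (\<Sum>i\<in>A. f i) = (\<Sum>i\<in>A. c *\<^sub>C (f i :: 'a::star_algebra_1))"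
  by (induction A rule: infinite_finite_induct) (simp_all add: scaleC_zero_right scaleC_add_right)

lemma scaleC_sum_left: "(\<Sum>i\<in>A. f i) *\<^sub>C x = (\<Sum>i\<in>A. f i *\<^sub>C (x :: 'a::star_algebra_1))"
  by (induction A rule: infinite_finite_induct) (simp_all add: scaleC_zero_left scaleC_add_left)

lemma star_zero: "star 0 = (0::'a::star_algebra_1)"
  using star_add[of 0 "0::'a"] by simp

lemma star_one: "star 1 = (1::'a::star_algebra_1)"
  by (metis mult.right_neutral star_mult star_star)

lemma star_sum: "star (\<Sum>i\<in>A. f i) = (\<Sum>i\<in>A. star (f i :: 'a::star_algebra_1))"
  by (induction A rule: infinite_finite_induct) (simp_all add: star_zero star_add)

lemma star_subalgebraD:
  assumes "star_subalgebra B"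
  shows "0 \<in> B" "x \<in> B \<Longrightarrow> y \<in> B \<Longrightarrow> x + y \<in> B" "x \<in> B \<Longrightarrow> y \<in> B \<Longrightarrow> x * y \<in> B"
    "x \<in> B \<Longrightarrow> c *\<^sub>C x \<in> B" "x \<in> B \<Longrightarrow> star x \<in> B"
  using assms unfolding star_subalgebra_def by blast+

lemma star_subalgebra_sum:
  "star_subalgebra B \<Longrightarrow> (\<And>i. i \<in> A \<Longrightarrow> f i \<in> B) \<Longrightarrow> (\<Sum>i\<in>A. f i) \<in> B"
  by (induction A rule: infinite_finite_induct) (simp_all add: star_subalgebraD)

lemma clinear_mapD:
  assumes "clinear_map D B P"
  shows "x \<in> D \<Longrightarrow> P x \<in> B" "x \<in> D \<Longrightarrow> y \<in> D \<Longrightarrow> P (x + y) = P x + P y"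
    "x \<in> D \<Longrightarrow> P (c *\<^sub>C x) = c *\<^sub>C P x"
  using assms unfolding clinear_map_def by blast+

lemma clinear_map_zero:
  assumes "clinear_map D B P" "star_subalgebra D"
  shows "P 0 = 0"
  using clinear_mapD(2)[OF assms(1), of 0 0] star_subalgebraD(1)[OF assms(2)] by simp

lemma clinear_map_sum:
  assumes "clinear_map D B P" "star_subalgebra D" "\<And>i. i \<in> A \<Longrightarrow> f i \<in> D"
  shows "P (\<Sum>i\<in>A. f i) = (\<Sum>i\<in>A. P (f i))"
proof -
  note P0 = clinear_map_zero[OF assms(1,2)]
  show ?thesis
    using assms(3)
    by (induction A rule: infinite_finite_induct)
      (simp_all add: P0 clinear_mapD(2)[OF assms(1)] star_subalgebra_sum[OF assms(2)])
qed

section \<open>Completely positive maps: finite index sets and compatibility with the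
  adjoint\<close>

lemma completely_positive_clinear: "completely_positive D B P \<Longrightarrow> clinear_map D B P"
  by (simp add: completely_positive_def)

text \<open>The definition indexes its form by the numbers below some \<open>m \<ge> 1\<close>,
  while later index sets are products \<open>K \<times> I\<close>. The form is transported along an
  enumeration of \<open>K\<close>; for empty \<open>K\<close> it is the empty sum of
  squares.\<close>

lemma completely_positive_finite:
  assumes "completely_positive D B P" "finite K" "\<And>j. j \<in> K \<Longrightarrow> b j \<in> B" "\<And>j. j \<in> K \<Longrightarrow> d j \<in> D"
  shows "positive_in B (\<Sum>j\<in>K. \<Sum>k\<in>K. star (b j) * P (star (d j) * d k) * b k)"
proof (cases "K = {}")
  case True
  thus ?thesis by (auto simp: positive_in_def intro!: exI[of _ 0])
next
  case False
  obtain h where h: "bij_betw h {..<card K} K"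
    using ex_bij_betw_nat_finite[OF assms(2)] by (auto simp: lessThan_atLeast0)
  have hK: "h j \<in> K" if "j < card K" for j
    using bij_betwE[OF h] that by blast
  have "card K \<ge> 1" using False assms(2) by (simp add: Suc_le_eq card_gt_0_iff)
  moreover have "\<forall>j<card K. b (h j) \<in> B \<and> d (h j) \<in> D" using assms(3,4) hK by blast
  ultimately have "positive_in B (\<Sum>j<card K. \<Sum>k<card K.
      star (b (h j)) * P (star (d (h j)) * d (h k)) * b (h k))"
    using assms(1)[unfolded completely_positive_def, THEN conjunct2, rule_format,
        of "card K" "\<lambda>j. b (h j)" "\<lambda>j. d (h j)"] by simp
  also have "(\<Sum>j<card K. \<Sum>k<card K. star (b (h j)) * P (star (d (h j)) * d (h k)) * b (h k)) =
      (\<Sum>j\<in>K. \<Sum>k\<in>K. star (b j) * P (star (d j) * d k) * b k)"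
    by (subst sum.reindex_bij_betw[OF h, symmetric], rule sum.cong[OF refl],
        rule sum.reindex_bij_betw[OF h])
  finally show ?thesis .
qed

lemma star_positive_in: "positive_in B x \<Longrightarrow> star x = x"
  by (auto simp: positive_in_def star_sum star_mult star_star)

text \<open>Positive elements are self-adjoint, so with \<open>b = 1\<close> the map
  \<open>P\<close> sends each \<open>star d * d\<close> to a self-adjoint element. Polarization with
  \<open>d = 1 + c *\<^sub>C y\<close>, for \<open>c = 1\<close> and \<open>c = \<i>\<close>,
  carries this over to all \<open>y\<close>.\<close>

lemma completely_positive_star:
  assumes "completely_positive D B P" "star_subalgebra D" "1 \<in> D" "1 \<in> B" "y \<in> D"
  shows "P (star y) = star (P y)"
proof -
  note lin = completely_positive_clinear[OF assms(1)]
  note alg = star_subalgebraD[OF assms(2)] assms(3,5)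
  have sq: "star (P (star d * d)) = P (star d * d)" if "d \<in> D" for d
    using completely_positive_finite[OF assms(1), of "{()}" "\<lambda>_. 1" "\<lambda>_. d"] assms(4) that
    by (intro star_positive_in[of B]) (simp add: star_one)
  have self: "star (cnj c *\<^sub>C P (star y) + c *\<^sub>C P y) = cnj c *\<^sub>C P (star y) + c *\<^sub>C P y" for c
  proof -
    let ?d = "1 + c *\<^sub>C y" and ?z = "star (c *\<^sub>C y) * (c *\<^sub>C y)"
    have "star ?d * ?d = (1 + ?z) + (cnj c *\<^sub>C star y + c *\<^sub>C y)"
      by (simp add: star_add star_one star_scaleC algebra_simps)
    hence "P (star ?d * ?d) = (P 1 + P ?z) + (cnj c *\<^sub>C P (star y) + c *\<^sub>C P y)"
      by (simp add: alg clinear_mapD[OF lin])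
    moreover have "star (P 1 + P ?z) = P 1 + P ?z"
      using sq[OF alg(6)] sq[OF alg(4)[OF alg(7)], of c] by (simp add: star_one star_add)
    moreover have "star (P (star ?d * ?d)) = P (star ?d * ?d)"
      by (rule sq) (simp add: alg)
    ultimately show ?thesis
      by (metis star_add add_left_cancel)
  qed
  let ?A = "P (star y)" and ?B = "P y"
  have 1: "star ?A + star ?B = ?A + ?B"
    using self[of 1] by (simp add: scaleC_one star_add)
  have 2: "\<i> *\<^sub>C star ?A + (- \<i>) *\<^sub>C star ?B = (- \<i>) *\<^sub>C ?A + \<i> *\<^sub>C ?B"
    \<comment> \<open>Multiplied by \<open>\<i>\<close>, this relation has the signs that make
      \<open>star ?A\<close> and \<open>?B\<close> cancel when it is added to the first one.\<close>
    using self[of \<i>] by (simp add: star_add star_scaleC)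
  have 3: "- star ?A + star ?B = ?A + - ?B"
    using arg_cong[OF 2, of "scaleC \<i>"]
    by (simp add: scaleC_add_right scaleC_scaleC scaleC_one scaleC_minus_one)
  have "star ?B + star ?B = ?A + ?A"
    using arg_cong2[OF 1 3, of "(+)"] by (simp add: algebra_simps)
  hence "2 *\<^sub>C star ?B = 2 *\<^sub>C ?A"
    by (simp add: scaleC_two)
  from arg_cong[OF this, of "scaleC (1/2)"] show ?thesis
    by (simp add: scaleC_scaleC scaleC_one)
qed

section \<open>Gram factorization of positive semidefinite matrices\<close>

text \<open>Membership in \<open>\<real>\<^sub>\<ge>\<^sub>0\<close> includes that the form is real,
  and Hermitian symmetry of \<open>x\<close> on a finite \<open>J\<close> follows from that.\<close>

definition psd_on :: "'i set \<Rightarrow> ('i \<Rightarrow> 'i \<Rightarrow> complex) \<Rightarrow> bool" where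
  "psd_on J x \<longleftrightarrow> (\<forall>\<xi>. (\<Sum>i\<in>J. \<Sum>j\<in>J. cnj (\<xi> i) * x i j * \<xi> j) \<in> \<real>\<^sub>\<ge>\<^sub>0)"

lemma psd_on_subset:
  fixes x :: "'i \<Rightarrow> 'i \<Rightarrow> complex"
  assumes "psd_on J x" "finite J" "K \<subseteq> J"
  shows "psd_on K x"
  unfolding psd_on_def
proof
  fix \<xi> :: "'i \<Rightarrow> complex"
  let ?\<eta> = "\<lambda>i. if i \<in> K then \<xi> i else 0"
  have "(\<Sum>i\<in>K. \<Sum>j\<in>K. cnj (\<xi> i) * x i j * \<xi> j) = (\<Sum>i\<in>K. \<Sum>j\<in>J. cnj (?\<eta> i) * x i j * ?\<eta> j)"
    by (intro sum.cong refl sum.mono_neutral_cong_left) (use assms in auto)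
  also have "\<dots> = (\<Sum>i\<in>J. \<Sum>j\<in>J. cnj (?\<eta> i) * x i j * ?\<eta> j)"
    by (intro sum.mono_neutral_left) (use assms in auto)
  also have "\<dots> \<in> \<real>\<^sub>\<ge>\<^sub>0"
    using assms(1) unfolding psd_on_def by (rule spec)
  finally show "(\<Sum>i\<in>K. \<Sum>j\<in>K. cnj (\<xi> i) * x i j * \<xi> j) \<in> \<real>\<^sub>\<ge>\<^sub>0" .
qed

lemma psd_on_diag:
  assumes "psd_on J x" "finite J" "a \<in> J"
  shows "x a a \<in> \<real>\<^sub>\<ge>\<^sub>0"
  using psd_on_subset[OF assms(1,2), of "{a}"] assms(3)
  by (auto simp: psd_on_def dest: spec[of _ "\<lambda>_. 1"])

lemma psd_on_pair:
  assumes "psd_on J x" "finite J" "a \<in> J" "b \<in> J" "a \<noteq> b"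
  shows "cnj \<alpha> * x a a * \<alpha> + cnj \<alpha> * x a b * \<beta> + cnj \<beta> * x b a * \<alpha> + cnj \<beta> * x b b * \<beta> \<in> \<real>\<^sub>\<ge>\<^sub>0"
proof -
  have "psd_on {a, b} x" by (rule psd_on_subset[OF assms(1,2)]) (use assms in auto)
  from this[unfolded psd_on_def, rule_format, of "\<lambda>i. if i = a then \<alpha> else \<beta>"] assms(5)
  show ?thesis by (simp add: add.assoc)
qed

text \<open>A form with real values is Hermitian: the vector \<open>(1, 1)\<close> gives opposite
  imaginary parts of the two off-diagonal entries, and \<open>(1, \<i>)\<close> gives equal real
  parts.\<close>

lemma psd_on_hermitian:
  assumes "psd_on J x" "finite J" "a \<in> J" "b \<in> J"
  shows "x b a = cnj (x a b)"
proof (cases "a = b")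
  case True
  thus ?thesis using psd_on_diag[OF assms(1-3)] by (simp add: complex_nonneg_Reals_iff complex_eq_iff)
next
  case False
  note pair = psd_on_pair[OF assms False]
  show ?thesis
    using pair[of 1 1] pair[of 1 \<i>] psd_on_diag[OF assms(1-3)] psd_on_diag[OF assms(1,2,4)]
    by (simp add: complex_nonneg_Reals_iff complex_eq_iff)
qed

lemma psd_on_zero_diag:
  assumes "psd_on J x" "finite J" "a \<in> J" "b \<in> J" "x a a = 0"
  shows "x a b = 0"
proof (rule ccontr)
  assume nz: "x a b \<noteq> 0"
  hence "a \<noteq> b" using assms(5) by auto
  \<comment> \<open>With \<open>x a a = 0\<close> the form at \<open>(- k * x a b, 1)\<close> has
    real part \<open>Re (x b b) - 2 * k * (cmod (x a b))\<^sup>2\<close>; this \<open>k\<close>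
    makes it equal to -1.\<close>
  define k where "k = (Re (x b b) + 1) / (2 * (cmod (x a b))\<^sup>2)"
  have sq: "cnj (x a b) * x a b = of_real ((cmod (x a b))\<^sup>2)"
    by (simp add: complex_norm_square mult.commute del: of_real_power)
  have "cnj (- of_real k * x a b) * x a b + cnj (x a b) * (- of_real k * x a b) + x b b \<in> \<real>\<^sub>\<ge>\<^sub>0"
    using psd_on_pair[OF assms(1-4) \<open>a \<noteq> b\<close>, of "- of_real k * x a b" 1] assms(5)
      psd_on_hermitian[OF assms(1-4)] by simp
  also have "cnj (- of_real k * x a b) * x a b + cnj (x a b) * (- of_real k * x a b) + x b b
      = x b b - 2 * of_real k * (cnj (x a b) * x a b)"
    by (simp add: algebra_simps)
  also have "\<dots> = x b b - of_real (2 * k * (cmod (x a b))\<^sup>2)"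
    by (simp add: sq del: of_real_power)
  also have "2 * k * (cmod (x a b))\<^sup>2 = Re (x b b) + 1"
    using nz by (simp add: k_def field_simps)
  finally show False by (simp add: complex_nonneg_Reals_iff)
qed

text \<open>The induction step is a Schur complement, as in the Cholesky factorization.\<close>

lemma psd_on_gram:
  assumes "finite J" "psd_on J x"
  shows "\<exists>(N::nat) y. \<forall>i\<in>J. \<forall>j\<in>J. x i j = (\<Sum>l<N. cnj (y l i) * y l j)"
  using assms
proof (induction J arbitrary: x rule: finite_induct)
  case empty
  thus ?case by simp
next
  case (insert a J)
  have fin: "finite (insert a J)" using insert.hyps by simp
  note psd = insert.prems fin
  have herm: "x i j = cnj (x j i)" if "i \<in> insert a J" "j \<in> insert a J" for i j
    using psd_on_hermitian[OF psd that(2,1)] .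
  have "x a a \<in> \<real>\<^sub>\<ge>\<^sub>0" by (rule psd_on_diag[OF psd]) simp
  then obtain d where d: "d \<ge> 0" "x a a = of_real d" by (auto elim: nonneg_Reals_cases)
  show ?case
  proof (cases "d = 0")
    case True
    hence zero: "x a j = 0" "x j a = 0" if "j \<in> insert a J" for j
      using psd_on_zero_diag[OF psd _ that, of a] herm[of j a] that d by auto
    have "psd_on J x" by (rule psd_on_subset[OF psd]) auto
    then obtain N y where y: "\<forall>i\<in>J. \<forall>j\<in>J. x i j = (\<Sum>l<(N::nat). cnj (y l i) * y l j)"
      using insert.IH by blast
    show ?thesis
      by (rule exI[of _ N], rule exI[of _ "\<lambda>l i. if i = a then 0 else y l i"])
        (use y zero insert.hyps in \<open>auto intro!: sum.cong\<close>)
  next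
    case False
    with d have dpos: "d > 0" by simp
    define x' where "x' i j = x i j - cnj (x a i) * x a j / of_real d" for i j
    have "psd_on J x'"
      unfolding psd_on_def
    proof
      fix \<xi>
      define S where "S = (\<Sum>j\<in>J. x a j * \<xi> j)"
      \<comment> \<open>Completing the square: for given \<open>\<xi>\<close> this entry at
        \<open>a\<close> minimizes the form of \<open>x\<close>, and the minimum is the form of
        \<open>x'\<close> at \<open>\<xi>\<close>.\<close>
      define \<eta> where "\<eta> i = (if i = a then - S / of_real d else \<xi> i)" for i
      have \<eta>J: "\<eta> i = \<xi> i" if "i \<in> J" for i using that insert.hyps by (auto simp: \<eta>_def)
      have S': "(\<Sum>i\<in>J. cnj (\<xi> i) * x i a) = cnj S"
        unfolding S_def cnj_sum
      proof (intro sum.cong refl)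
        fix i assume "i \<in> J"
        hence "x i a = cnj (x a i)" by (intro herm) auto
        thus "cnj (\<xi> i) * x i a = cnj (x a i * \<xi> i)" by simp
      qed
      have row: "(\<Sum>j\<in>J. cnj (\<eta> a) * x a j * \<xi> j) = cnj (\<eta> a) * S"
        by (simp add: S_def sum_distrib_left mult.assoc)
      have col: "(\<Sum>i\<in>J. cnj (\<xi> i) * x i a * \<eta> a) = cnj S * \<eta> a"
        by (simp only: S'[symmetric] sum_distrib_right)
      have "(\<Sum>i\<in>insert a J. \<Sum>j\<in>insert a J. cnj (\<eta> i) * x i j * \<eta> j) =
          (cnj (\<eta> a) * x a a * \<eta> a + (\<Sum>j\<in>J. cnj (\<eta> a) * x a j * \<xi> j)) +
          ((\<Sum>i\<in>J. cnj (\<xi> i) * x i a * \<eta> a) + (\<Sum>i\<in>J. \<Sum>j\<in>J. cnj (\<xi> i) * x i j * \<xi> j))"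
        using insert.hyps by (simp add: sum.distrib \<eta>J cong: sum.cong)
      also have "\<dots> = (\<Sum>i\<in>J. \<Sum>j\<in>J. cnj (\<xi> i) * x i j * \<xi> j) +
          (cnj (\<eta> a) * x a a * \<eta> a + cnj (\<eta> a) * S + cnj S * \<eta> a)"
        unfolding row col by (simp only: ac_simps)
      also have "cnj (\<eta> a) * x a a * \<eta> a + cnj (\<eta> a) * S + cnj S * \<eta> a = - (cnj S * S / of_real d)"
        using dpos by (simp add: \<eta>_def d)
      also have "cnj S * S / of_real d =
          (\<Sum>i\<in>J. \<Sum>j\<in>J. cnj (\<xi> i) * (cnj (x a i) * x a j / of_real d) * \<xi> j)"
        unfolding S_def cnj_sum sum_product sum_divide_distrib
        by (intro sum.cong refl) (simp add: field_simps)
      finally have form: "(\<Sum>i\<in>insert a J. \<Sum>j\<in>insert a J. cnj (\<eta> i) * x i j * \<eta> j) =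
          (\<Sum>i\<in>J. \<Sum>j\<in>J. cnj (\<xi> i) * x i j * \<xi> j) +
          - (\<Sum>i\<in>J. \<Sum>j\<in>J. cnj (\<xi> i) * (cnj (x a i) * x a j / of_real d) * \<xi> j)" .
      have "(\<Sum>i\<in>J. \<Sum>j\<in>J. cnj (\<xi> i) * x' i j * \<xi> j) =
          (\<Sum>i\<in>J. \<Sum>j\<in>J. cnj (\<xi> i) * x i j * \<xi> j) -
          (\<Sum>i\<in>J. \<Sum>j\<in>J. cnj (\<xi> i) * (cnj (x a i) * x a j / of_real d) * \<xi> j)"
        by (simp only: x'_def right_diff_distrib left_diff_distrib sum_subtractf)
      also have "\<dots> = (\<Sum>i\<in>insert a J. \<Sum>j\<in>insert a J. cnj (\<eta> i) * x i j * \<eta> j)"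
        by (simp only: form diff_conv_add_uminus)
      also have "\<dots> \<in> \<real>\<^sub>\<ge>\<^sub>0"
        using insert.prems unfolding psd_on_def by (rule spec)
      finally show "(\<Sum>i\<in>J. \<Sum>j\<in>J. cnj (\<xi> i) * x' i j * \<xi> j) \<in> \<real>\<^sub>\<ge>\<^sub>0" .
    qed
    then obtain N y where y: "\<forall>i\<in>J. \<forall>j\<in>J. x' i j = (\<Sum>l<(N::nat). cnj (y l i) * y l j)"
      using insert.IH by blast
    \<comment> \<open>Row 0 reproduces the rank-one term split off in \<open>x'\<close>. The other
      rows factor \<open>x'\<close> and are padded with 0 at \<open>a\<close>, where
      \<open>x'\<close> vanishes.\<close>
    define z where "z l i = (case l of 0 \<Rightarrow> x a i / of_real (sqrt d)
      | Suc l \<Rightarrow> if i = a then 0 else y l i)" for l i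
    have sqrt: "complex_of_real (sqrt d) * complex_of_real (sqrt d) = of_real d"
      using dpos by (simp flip: of_real_mult)
    have sum_z: "(\<Sum>l<Suc N. cnj (z l i) * z l j) = cnj (x a i) * x a j / of_real d +
        (\<Sum>l<N. if i = a \<or> j = a then 0 else cnj (y l i) * y l j)" for i j
      unfolding sum.lessThan_Suc_shift by (simp add: z_def sqrt) (auto intro!: sum.cong)
    have "x i j = (\<Sum>l<Suc N. cnj (z l i) * z l j)"
      if "i \<in> insert a J" "j \<in> insert a J" for i j
    proof (cases "i = a \<or> j = a")
      case True
      have "x i j = cnj (x a i) * x a j / of_real d"
      proof (cases "i = a")
        case False
        with True have "x i j = cnj (x a i)" using herm[OF that] by simp
        with True False dpos d show ?thesis by simp
      qed (use dpos d in simp)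
      with True show ?thesis unfolding sum_z by auto
    next
      case False
      hence "x' i j = (\<Sum>l<N. cnj (y l i) * y l j)" using y that by auto
      thus ?thesis using False unfolding sum_z by (simp add: x'_def diff_eq_eq)
    qed
    thus ?thesis by blast
  qed
qed

section \<open>Matrix units\<close>

text \<open>The index is a set and not a type because the later instances are indexed by
  configurations of the first \<open>n\<close> sites, with \<open>n\<close> varying.\<close>

locale matrix_units =
  fixes I :: "'i set" and e :: "'i \<Rightarrow> 'i \<Rightarrow> 'a::star_algebra_1"
  assumes finite_index: "finite I"
    and unit_mult: "s \<in> I \<Longrightarrow> t \<in> I \<Longrightarrow> u \<in> I \<Longrightarrow> v \<in> I \<Longrightarrow>
      e s t * e u v = (if t = u then e s v else 0)"
    and unit_star: "s \<in> I \<Longrightarrow> t \<in> I \<Longrightarrow> star (e s t) = e t s"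
    and unit_sum: "(\<Sum>s\<in>I. e s s) = 1"
begin

text \<open>The \<open>(s, t)\<close> entry of \<open>x\<close> when the algebra is viewed as the
  \<open>I\<close>-by-\<open>I\<close> matrices over the commutant of the units; products and
  adjoints then follow the matrix rules \<open>coef_mult\<close> and
  \<open>coef_star\<close>.\<close>

definition coef :: "'i \<Rightarrow> 'i \<Rightarrow> 'a \<Rightarrow> 'a" where
  "coef s t x = (\<Sum>u\<in>I. e u s * x * e t u)"

definition commuting :: "'a \<Rightarrow> bool" where
  "commuting c \<longleftrightarrow> (\<forall>s\<in>I. \<forall>t\<in>I. c * e s t = e s t * c)"

lemma index_nonempty: "I \<noteq> {}"
  using unit_sum by auto

lemma coef_add: "coef s t (x + y) = coef s t x + coef s t y"
  by (simp add: coef_def algebra_simps sum.distrib)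

lemma coef_zero: "coef s t 0 = 0"
  by (simp add: coef_def)

lemma coef_scaleC: "coef s t (c *\<^sub>C x) = c *\<^sub>C coef s t x"
  by (simp add: coef_def mult_scaleC_left mult_scaleC_right scaleC_sum_right)

lemma coef_sum: "coef s t (\<Sum>k\<in>K. f k) = (\<Sum>k\<in>K. coef s t (f k))"
  by (induction K rule: infinite_finite_induct) (simp_all add: coef_zero coef_add)

text \<open>Only the summand \<open>u = q\<close> of \<open>coef i j x\<close> survives
  multiplication by \<open>e p q\<close>. The rule trades a compression between units for a
  coefficient; the expansion, the product formula and the quadratic form all rest on it.\<close>

lemma unit_sandwich:
  assumes "p \<in> I" "q \<in> I" "i \<in> I" "j \<in> I"
  shows "e p i * x * e j q = e p q * coef i j x"
proof -
  have "e p q * coef i j x = (\<Sum>u\<in>I. (e p q * e u i) * (x * e j u))"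
    by (simp add: coef_def sum_distrib_left mult.assoc)
  also have "\<dots> = (\<Sum>u\<in>I. if q = u then e p i * x * e j u else 0)"
    using assms by (intro sum.cong) (auto simp: unit_mult mult.assoc)
  finally show ?thesis using assms finite_index by simp
qed

lemma expand: "x = (\<Sum>s\<in>I. \<Sum>t\<in>I. e s t * coef s t x)"
proof -
  have "x = (\<Sum>s\<in>I. e s s) * x * (\<Sum>t\<in>I. e t t)" by (simp add: unit_sum)
  also have "\<dots> = (\<Sum>s\<in>I. \<Sum>t\<in>I. e s s * x * e t t)"
    by (simp add: sum_distrib_left sum_distrib_right)
      (subst sum.swap, simp)
  also have "\<dots> = (\<Sum>s\<in>I. \<Sum>t\<in>I. e s t * coef s t x)"
    by (intro sum.cong refl unit_sandwich)
  finally show ?thesis .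
qed

lemma coef_eqI: "(\<And>s t. s \<in> I \<Longrightarrow> t \<in> I \<Longrightarrow> coef s t x = coef s t y) \<Longrightarrow> x = y"
  by (subst expand, subst (2) expand) simp

lemma coef_mult:
  assumes "s \<in> I" "t \<in> I"
  shows "coef s t (x * y) = (\<Sum>r\<in>I. coef s r x * coef r t y)"
proof -
  have "(\<Sum>r\<in>I. coef s r x * coef r t y) = (\<Sum>r\<in>I. \<Sum>u\<in>I. e u s * x * (e r u * coef r t y))"
    by (simp add: coef_def[of s] sum_distrib_right mult.assoc)
  also have "\<dots> = (\<Sum>r\<in>I. \<Sum>u\<in>I. e u s * x * e r r * (y * e t u))"
    using assms by (intro sum.cong refl) (simp add: mult.assoc flip: unit_sandwich)
  also have "\<dots> = (\<Sum>u\<in>I. e u s * x * (\<Sum>r\<in>I. e r r) * (y * e t u))"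
    by (subst sum.swap) (simp add: sum_distrib_left sum_distrib_right)
  finally show ?thesis by (simp add: unit_sum coef_def mult.assoc)
qed

lemma coef_star:
  assumes "s \<in> I" "t \<in> I"
  shows "coef s t (star x) = star (coef t s x)"
  using assms by (simp add: coef_def star_sum star_mult unit_star mult.assoc)

lemma coef_unit_mult:
  assumes "s \<in> I" "t \<in> I" "p \<in> I" "q \<in> I" "commuting c"
  shows "coef s t (e p q * c) = (if p = s \<and> q = t then c else 0)"
proof -
  have "coef s t (e p q * c) = (\<Sum>u\<in>I. e u s * e p q * e t u * c)"
    unfolding coef_def using assms(1,2,5) by (intro sum.cong) (simp_all add: commuting_def mult.assoc)
  also have "\<dots> = (\<Sum>u\<in>I. if p = s \<and> q = t then e u u * c else 0)"
    using assms by (intro sum.cong) (auto simp: unit_mult)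
  also have "\<dots> = (if p = s \<and> q = t then (\<Sum>u\<in>I. e u u) * c else 0)"
    by (auto simp: sum_distrib_right)
  finally show ?thesis by (simp add: unit_sum)
qed

lemma coef_commuting:
  assumes "s \<in> I" "t \<in> I" "commuting c"
  shows "coef s t c = (if s = t then c else 0)"
proof -
  have "coef s t c = (\<Sum>u\<in>I. e u s * e t u * c)"
    unfolding coef_def using assms by (intro sum.cong) (simp_all add: commuting_def mult.assoc)
  also have "\<dots> = (\<Sum>u\<in>I. if s = t then e u u * c else 0)"
    using assms by (intro sum.cong) (auto simp: unit_mult)
  also have "\<dots> = (if s = t then (\<Sum>u\<in>I. e u u) * c else 0)"
    by (auto simp: sum_distrib_right)
  finally show ?thesis by (simp add: unit_sum)
qed

lemma commuting_scalar: "commuting (c *\<^sub>C 1)"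
  by (simp add: commuting_def mult_scaleC_left mult_scaleC_right)

text \<open>For \<open>S\<close> commuting with the units this is the tensor product of the matrix
  algebra with \<open>S\<close>. Describing it by coefficients and not as a span makes closedness a
  matter of preimages under continuous maps.\<close>

definition amplification :: "'a set \<Rightarrow> 'a set" where
  "amplification S = {x. \<forall>s\<in>I. \<forall>t\<in>I. coef s t x \<in> S}"

lemma amplificationD: "x \<in> amplification S \<Longrightarrow> s \<in> I \<Longrightarrow> t \<in> I \<Longrightarrow> coef s t x \<in> S"
  by (simp add: amplification_def)

lemma star_subalgebra_amplification:
  assumes "star_subalgebra S"
  shows "star_subalgebra (amplification S)"
  unfolding star_subalgebra_def[of "amplification S"]
  by (auto simp: amplification_def coef_zero coef_add coef_scaleC coef_star coef_mult
      star_subalgebraD[OF assms] intro!: star_subalgebra_sum[OF assms])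

lemma unit_mult_mem_amplification:
  assumes "star_subalgebra S" "c \<in> S" "commuting c" "p \<in> I" "q \<in> I"
  shows "e p q * c \<in> amplification S"
  using assms by (auto simp: amplification_def coef_unit_mult star_subalgebraD)

end

section \<open>The entrywise extension of a completely positive map\<close>

locale matrix_units_extension = matrix_units I e
  for I :: "'i set" and e :: "'i \<Rightarrow> 'i \<Rightarrow> 'a::star_algebra_1" +
  fixes S M :: "'a set" and E :: "'a \<Rightarrow> 'a"
  assumes cp: "completely_positive S M E"
    and alg: "star_subalgebra S" and one_S: "1 \<in> S" and one_M: "1 \<in> M"
    and commuting_S: "c \<in> S \<Longrightarrow> commuting c"
    and commuting_M: "c \<in> M \<Longrightarrow> commuting c"
begin

text \<open>The amplification \<open>id \<otimes> E\<close>: on matrices over \<open>S\<close> it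
  applies \<open>E\<close> to every entry.\<close>

definition ext :: "'a \<Rightarrow> 'a" where
  "ext x = (\<Sum>s\<in>I. \<Sum>t\<in>I. e s t * E (coef s t x))"

lemma linear: "clinear_map S M E"
  by (rule completely_positive_clinear[OF cp])

lemma amplification_alg: "star_subalgebra (amplification S)"
  by (rule star_subalgebra_amplification[OF alg])

text \<open>The values of \<open>E\<close> commute with the units, so the sum defining
  \<open>ext x\<close> is already the expansion of \<open>ext x\<close> into its coefficients.
  Together with \<open>coef_eqI\<close> this allows properties of \<open>ext\<close> to be checked
  entry by entry.\<close>

lemma coef_ext:
  assumes "x \<in> amplification S" "s \<in> I" "t \<in> I"
  shows "coef s t (ext x) = E (coef s t x)"
proof -
  have comm: "commuting (E (coef p q x))" if "p \<in> I" "q \<in> I" for p q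
    using that assms(1) by (intro commuting_M clinear_mapD(1)[OF linear] amplificationD)
  have "coef s t (ext x) = (\<Sum>p\<in>I. \<Sum>q\<in>I. if p = s then if q = t then E (coef p q x) else 0 else 0)"
    unfolding ext_def coef_sum
    using assms by (intro sum.cong refl) (simp add: coef_unit_mult comm)
  also have "\<dots> = (\<Sum>p\<in>I. if p = s then (\<Sum>q\<in>I. if q = t then E (coef p q x) else 0) else 0)"
    by (intro sum.cong) auto
  finally show ?thesis using assms finite_index by simp
qed

lemma ext_add:
  assumes "x \<in> amplification S" "y \<in> amplification S"
  shows "ext (x + y) = ext x + ext y"
  by (simp add: ext_def coef_add clinear_mapD[OF linear] amplificationD[OF assms(1)]
      amplificationD[OF assms(2)] distrib_left sum.distrib)

lemma ext_scaleC:
  assumes "x \<in> amplification S"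
  shows "ext (c *\<^sub>C x) = c *\<^sub>C ext x"
  by (simp add: ext_def coef_scaleC clinear_mapD[OF linear] amplificationD[OF assms]
      mult_scaleC_right scaleC_sum_right)

lemma ext_star:
  assumes "x \<in> amplification S"
  shows "ext (star x) = star (ext x)"
proof (rule coef_eqI)
  fix s t assume st: "s \<in> I" "t \<in> I"
  have "star x \<in> amplification S" using assms by (rule star_subalgebraD(5)[OF amplification_alg])
  hence "coef s t (ext (star x)) = E (star (coef t s x))"
    using st by (simp add: coef_ext coef_star)
  also have "\<dots> = star (E (coef t s x))"
    by (rule completely_positive_star[OF cp alg one_S one_M amplificationD[OF assms st(2,1)]])
  finally show "coef s t (ext (star x)) = coef s t (star (ext x))"
    using st assms by (simp add: coef_ext coef_star)
qed

text \<open>The entries of \<open>c\<close> are scalars, so each entry of \<open>c * x\<close> is a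
  scalar combination of entries of \<open>x\<close>, and the module property reduces to complex
  linearity of \<open>E\<close>.\<close>

lemma ext_module:
  assumes c: "c \<in> amplification (range (\<lambda>z. z *\<^sub>C 1))" and x: "x \<in> amplification S"
  shows "ext (c * x) = c * ext x"
proof (rule coef_eqI)
  fix s t assume st: "s \<in> I" "t \<in> I"
  have coef_mult_x: "\<exists>z. \<forall>y. coef s r c * y = z *\<^sub>C y" if "r \<in> I" for r
    using amplificationD[OF c st(1) that] by (auto simp: mult_scaleC_left)
  then obtain z where z: "\<And>r y. r \<in> I \<Longrightarrow> coef s r c * y = z r *\<^sub>C y" by metis
  have range_S: "range (\<lambda>z. z *\<^sub>C 1) \<subseteq> S" using star_subalgebraD(4)[OF alg one_S] by auto
  have "c \<in> amplification S" using c range_S unfolding amplification_def by auto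
  hence "c * x \<in> amplification S" using x by (rule star_subalgebraD(3)[OF amplification_alg])
  hence "coef s t (ext (c * x)) = E (\<Sum>r\<in>I. z r *\<^sub>C coef r t x)"
    using st by (simp add: coef_ext coef_mult z)
  also have "\<dots> = (\<Sum>r\<in>I. z r *\<^sub>C E (coef r t x))"
    by (subst clinear_map_sum[OF linear alg])
      (use x st in \<open>simp_all add: star_subalgebraD[OF alg] amplificationD clinear_mapD[OF linear]\<close>)
  finally show "coef s t (ext (c * x)) = coef s t (c * ext x)"
    using st x by (simp add: coef_ext coef_mult z)
qed

lemma amplification_S: "b \<in> S \<Longrightarrow> b \<in> amplification S"
  by (simp add: amplification_def coef_commuting commuting_S star_subalgebraD[OF alg])

lemma ext_base:
  assumes "b \<in> S"
  shows "ext b = E b"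
proof (rule coef_eqI)
  fix s t assume st: "s \<in> I" "t \<in> I"
  have "commuting (E b)" using assms by (intro commuting_M clinear_mapD(1)[OF linear])
  thus "coef s t (ext b) = coef s t (E b)"
    using st coef_ext[OF amplification_S[OF assms] st] commuting_S[OF assms]
    by (simp add: coef_commuting clinear_map_zero[OF linear alg])
qed

text \<open>By \<open>expand\<close>, the products \<open>e s t * b\<close> with
  \<open>b \<in> S\<close> span \<open>amplification S\<close>, so a linear map is determined by its
  values on them.\<close>

lemma ext_unique:
  assumes "clinear_map (amplification S) B G"
    and "\<And>s t b. s \<in> I \<Longrightarrow> t \<in> I \<Longrightarrow> b \<in> S \<Longrightarrow> G (e s t * b) = e s t * E b"
    and x: "x \<in> amplification S"
  shows "G x = ext x"
proof -
  have term_mem: "e s t * coef s t x \<in> amplification S" if "s \<in> I" "t \<in> I" for s t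
    using that x by (intro unit_mult_mem_amplification alg commuting_S amplificationD)
  have "G x = G (\<Sum>s\<in>I. \<Sum>t\<in>I. e s t * coef s t x)"
    by (subst expand) (rule refl)
  also have "\<dots> = (\<Sum>s\<in>I. \<Sum>t\<in>I. G (e s t * coef s t x))"
    using term_mem
    by (simp add: clinear_map_sum[OF assms(1) amplification_alg] star_subalgebra_sum[OF amplification_alg])
  also have "\<dots> = ext x"
    using assms(2) x by (simp add: ext_def amplificationD)
  finally show ?thesis .
qed

text \<open>The diagonal coefficients of the form in the definition of complete positivity of \<open>ext\<close> are
  sums, over the row index of the \<open>d j\<close>, of forms for \<open>E\<close> with the enlarged index set \<open>K \<times> I\<close>.\<close>

lemma coef_ext_form_positive:
  assumes K: "finite K" and b: "\<And>j p q. j \<in> K \<Longrightarrow> p \<in> I \<Longrightarrow> q \<in> I \<Longrightarrow> coef p q (b j) \<in> M"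
    and d: "\<And>j. j \<in> K \<Longrightarrow> d j \<in> amplification S" and q: "q \<in> I"
  shows "\<exists>Z. (\<forall>s\<in>I. positive_in M (Z s)) \<and>
    coef q q (\<Sum>j\<in>K. \<Sum>k\<in>K. star (b j) * ext (star (d j) * d k) * b k) = (\<Sum>s\<in>I. Z s)"
proof (intro exI conjI ballI)
  let ?b = "\<lambda>(j, p). coef p q (b j)" and ?d = "\<lambda>s (j, p). coef s p (d j)"
  let ?Z = "\<lambda>s. \<Sum>x\<in>K\<times>I. \<Sum>y\<in>K\<times>I. star (?b x) * E (star (?d s x) * ?d s y) * ?b y"
  show "positive_in M (?Z s)" if "s \<in> I" for s
    by (rule completely_positive_finite[OF cp])
      (use that K b d q finite_index in \<open>auto simp: amplificationD\<close>)
  have E: "E (coef p r (star (d j) * d k)) =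
      (\<Sum>s\<in>I. E (star (coef s p (d j)) * coef s r (d k)))"
    if "j \<in> K" "k \<in> K" "p \<in> I" "r \<in> I" for j k p r
    using that
    by (simp add: coef_mult coef_star)
      (subst clinear_map_sum[OF linear alg], auto simp: star_subalgebraD[OF alg] amplificationD d)
  have one: "coef q q (star (b j) * ext (star (d j) * d k) * b k) =
      (\<Sum>p\<in>I. \<Sum>r\<in>I. \<Sum>s\<in>I.
        star (coef p q (b j)) * E (star (coef s p (d j)) * coef s r (d k)) * coef r q (b k))"
    if jk: "j \<in> K" "k \<in> K" for j k
  proof -
    have mem: "star (d j) * d k \<in> amplification S"
      by (simp add: star_subalgebraD[OF amplification_alg] d jk)
    show ?thesis
      using q jk
      by (simp add: mult.assoc coef_mult[of q] coef_mult[of _ q] coef_star[of q] coef_ext[OF mem] E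
          sum_distrib_left sum_distrib_right cong: sum.cong)
  qed
  have "coef q q (\<Sum>j\<in>K. \<Sum>k\<in>K. star (b j) * ext (star (d j) * d k) * b k) =
      (\<Sum>j\<in>K. \<Sum>k\<in>K. \<Sum>p\<in>I. \<Sum>r\<in>I. \<Sum>s\<in>I.
        star (coef p q (b j)) * E (star (coef s p (d j)) * coef s r (d k)) * coef r q (b k))"
    by (simp add: coef_sum one)
  \<comment> \<open>The sums are regrouped into the pairs \<open>(j, p)\<close> and
    \<open>(k, r)\<close>, and \<open>s\<close> is then moved outermost, leaving one form for
    \<open>E\<close> per \<open>s\<close>.\<close>
  also have "\<dots> = (\<Sum>j\<in>K. \<Sum>p\<in>I. \<Sum>k\<in>K. \<Sum>r\<in>I. \<Sum>s\<in>I.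
        star (coef p q (b j)) * E (star (coef s p (d j)) * coef s r (d k)) * coef r q (b k))"
    by (intro sum.cong refl) (rule sum.swap)
  also have "\<dots> = (\<Sum>x\<in>K\<times>I. \<Sum>y\<in>K\<times>I. \<Sum>s\<in>I. star (?b x) * E (star (?d s x) * ?d s y) * ?b y)"
    by (simp add: sum.cartesian_product' case_prod_unfold)
  also have "\<dots> = (\<Sum>x\<in>K\<times>I. \<Sum>s\<in>I. \<Sum>y\<in>K\<times>I. star (?b x) * E (star (?d s x) * ?d s y) * ?b y)"
    by (intro sum.cong refl) (rule sum.swap)
  also have "\<dots> = (\<Sum>s\<in>I. ?Z s)"
    by (rule sum.swap)
  finally show "coef q q (\<Sum>j\<in>K. \<Sum>k\<in>K. star (b j) * ext (star (d j) * d k) * b k) = (\<Sum>s\<in>I. ?Z s)" .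
qed

end

section \<open>Operators with scalar coefficients\<close>

context matrix_units
begin

lemma psd_positive_in:
  assumes "psd_on I x" "star_subalgebra B" "\<And>s t. s \<in> I \<Longrightarrow> t \<in> I \<Longrightarrow> e s t \<in> B"
  shows "positive_in B (\<Sum>s\<in>I. \<Sum>t\<in>I. x s t *\<^sub>C e s t)"
proof -
  obtain N y where y: "\<forall>s\<in>I. \<forall>t\<in>I. x s t = (\<Sum>l<(N::nat). cnj (y l s) * y l t)"
    using psd_on_gram[OF finite_index assms(1)] by blast
  obtain p where p: "p \<in> I" using index_nonempty by blast
  \<comment> \<open>Each Gram vector is placed in the single row \<open>p\<close>, so that
    \<open>star (c l) * c l\<close> is the rank-one matrix built from \<open>y l\<close>.\<close>
  define c where "c l = (\<Sum>t\<in>I. y l t *\<^sub>C e p t)" for l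
  have sq: "star (c l) * c l = (\<Sum>s\<in>I. \<Sum>t\<in>I. (cnj (y l s) * y l t) *\<^sub>C e s t)" for l
    using p by (simp add: c_def star_sum star_scaleC unit_star sum_product mult_scaleC_left
        mult_scaleC_right scaleC_scaleC unit_mult mult.commute)
  have "(\<Sum>s\<in>I. \<Sum>t\<in>I. x s t *\<^sub>C e s t) =
      (\<Sum>s\<in>I. \<Sum>t\<in>I. \<Sum>l<N. (cnj (y l s) * y l t) *\<^sub>C e s t)"
    using y by (simp add: scaleC_sum_left)
  also have "\<dots> = (\<Sum>s\<in>I. \<Sum>l<N. \<Sum>t\<in>I. (cnj (y l s) * y l t) *\<^sub>C e s t)"
    by (intro sum.cong refl) (rule sum.swap)
  also have "\<dots> = (\<Sum>l<N. star (c l) * c l)"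
    unfolding sq by (rule sum.swap)
  finally have "(\<Sum>s\<in>I. \<Sum>t\<in>I. x s t *\<^sub>C e s t) = (\<Sum>l<N. star (c l) * c l)" .
  moreover have "c l \<in> B" for l
    unfolding c_def using p assms(2,3) by (intro star_subalgebra_sum star_subalgebraD(4))
  ultimately show ?thesis unfolding positive_in_def by blast
qed

lemma unit_mem_amplification_scalars:
  "s \<in> I \<Longrightarrow> t \<in> I \<Longrightarrow> e s t \<in> amplification (range (\<lambda>z. z *\<^sub>C 1))"
  using coef_unit_mult[OF _ _ _ _ commuting_scalar[of 1]]
  by (auto simp: amplification_def scaleC_one intro: range_eqI[of _ _ 1] range_eqI[of _ _ 0]
      simp flip: scaleC_zero_left[of 1])

lemma amplification_scalarsE:
  assumes "T \<in> amplification (range (\<lambda>z. z *\<^sub>C 1))"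
  obtains x where "\<And>s t. s \<in> I \<Longrightarrow> t \<in> I \<Longrightarrow> coef s t T = x s t *\<^sub>C 1"
    and "T = (\<Sum>s\<in>I. \<Sum>t\<in>I. x s t *\<^sub>C e s t)"
proof -
  have "\<forall>s\<in>I. \<forall>t\<in>I. \<exists>z. coef s t T = z *\<^sub>C 1"
    using assms by (auto simp: amplification_def)
  then obtain x where x: "\<And>s t. s \<in> I \<Longrightarrow> t \<in> I \<Longrightarrow> coef s t T = x s t *\<^sub>C 1"
    by metis
  have "T = (\<Sum>s\<in>I. \<Sum>t\<in>I. e s t * coef s t T)" by (rule expand)
  also have "\<dots> = (\<Sum>s\<in>I. \<Sum>t\<in>I. x s t *\<^sub>C e s t)"
    by (simp add: x mult_scaleC_right)
  finally show ?thesis using that x by blast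
qed

lemma quadratic_form_unit:
  assumes x: "\<And>s t. s \<in> I \<Longrightarrow> t \<in> I \<Longrightarrow> coef s t T = x s t *\<^sub>C 1" and p: "p \<in> I"
  defines "c \<equiv> \<lambda>\<xi>. \<Sum>t\<in>I. \<xi> t *\<^sub>C e t p"
  shows "star (c \<xi>) * T * c \<xi> = (\<Sum>s\<in>I. \<Sum>t\<in>I. cnj (\<xi> s) * x s t * \<xi> t) *\<^sub>C e p p"
proof -
  have "star (c \<xi>) * T * c \<xi> = (\<Sum>s\<in>I. \<Sum>t\<in>I. (cnj (\<xi> s) * \<xi> t) *\<^sub>C (e p s * T * e t p))"
    using p by (simp add: c_def star_sum star_scaleC unit_star sum_distrib_right sum_distrib_left
        mult_scaleC_left mult_scaleC_right scaleC_scaleC scaleC_sum_right mult.commute)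
      (rule sum.swap)
  also have "\<dots> = (\<Sum>s\<in>I. \<Sum>t\<in>I. (cnj (\<xi> s) * x s t * \<xi> t) *\<^sub>C e p p)"
    using p by (intro sum.cong refl)
      (simp add: unit_sandwich x mult_scaleC_right scaleC_scaleC, simp add: mult_ac)
  finally show ?thesis by (simp add: scaleC_sum_left)
qed

end

text \<open>Used to pass from \<open>ext\<close> to its restriction, which is the extensional
  representative of the same map.\<close>

lemma completely_positive_cong:
  assumes "completely_positive D B P" "star_subalgebra D" "\<And>x. x \<in> D \<Longrightarrow> P x = P' x"
  shows "completely_positive D B P'"
proof -
  have "(\<Sum>j<m. \<Sum>k<m. star (b j) * P' (star (d j) * d k) * b k) =
      (\<Sum>j<m. \<Sum>k<m. star (b j) * P (star (d j) * d k) * b k)"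
    if "\<forall>j<m. b j \<in> B \<and> d j \<in> D" for m :: nat and b d
    using that by (intro sum.cong refl) (simp add: assms(3) star_subalgebraD[OF assms(2)])
  moreover have "clinear_map D B P'"
    using completely_positive_clinear[OF assms(1)]
    by (auto simp: clinear_map_def Pi_iff star_subalgebraD[OF assms(2)] simp flip: assms(3))
  ultimately show ?thesis
    using assms(1) unfolding completely_positive_def by simp
qed

section \<open>Positive operators and generated C*-algebras\<close>

text \<open>A notion of positivity that does not depend on a subalgebra; it extracts the sign of a
  scalar from a sum of squares.\<close>

definition nonneg_op :: "'i bop \<Rightarrow> bool" where
  "nonneg_op T \<longleftrightarrow> (\<forall>v. cinner v (bop_apply T v) \<in> \<real>\<^sub>\<ge>\<^sub>0)"

lemma nonneg_op_add: "nonneg_op S \<Longrightarrow> nonneg_op T \<Longrightarrow> nonneg_op (S + T)"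
  by (simp add: nonneg_op_def bop_apply_simps cinner_add_right)

lemma nonneg_op_sum: "(\<And>i. i \<in> A \<Longrightarrow> nonneg_op (f i)) \<Longrightarrow> nonneg_op (\<Sum>i\<in>A. f i)"
  by (induction A rule: infinite_finite_induct)
    (simp_all add: nonneg_op_add, simp_all add: nonneg_op_def bop_apply_simps cinner_simps)

lemma cinner_star_mult_self:
  "cinner v (bop_apply (star c * c) v) = of_real ((norm (bop_apply c v))\<^sup>2)"
  by (simp add: bop_apply_simps cinner_self_norm flip: cinner_star)

lemma positive_in_nonneg_op: "positive_in B x \<Longrightarrow> nonneg_op x"
  unfolding positive_in_def
  by (elim exE conjE, hypsubst, rule nonneg_op_sum)
    (simp add: nonneg_op_def cinner_star_mult_self del: of_real_power)

text \<open>At a vector \<open>v\<close> the form is \<open>r\<close> times the squared norm of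
  \<open>bop_apply c v\<close>, and some \<open>v\<close> makes that norm nonzero.\<close>

lemma nonneg_op_scaleC_square:
  assumes "nonneg_op (r *\<^sub>C (star c * c))" "c \<noteq> 0"
  shows "r \<in> \<real>\<^sub>\<ge>\<^sub>0"
proof -
  obtain v where v: "bop_apply c v \<noteq> 0"
    using assms(2) by (metis bop_apply_simps(1) bop_eqI)
  let ?n = "(norm (bop_apply c v))\<^sup>2"
  have "r * of_real ?n \<in> \<real>\<^sub>\<ge>\<^sub>0"
    using assms(1) unfolding nonneg_op_def
    by (metis bop_apply_simps(7) cinner_scaleC_right cinner_star_mult_self)
  hence "r * of_real ?n / of_real ?n \<in> \<real>\<^sub>\<ge>\<^sub>0"
    by (rule nonneg_Reals_divide_I) (simp del: of_real_power)
  thus ?thesis using v by simp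
qed

section \<open>The scalars as a closed subalgebra\<close>

lemma scaleC_of_real_bop: "of_real r *\<^sub>C (x :: 'i bop) = r *\<^sub>R x"
  by (rule bop_eqI) (simp add: bop_apply_simps scaleR_ell2_eq)

lemma norm_scaleC_one: "norm (c *\<^sub>C (1 :: 'i bop)) = cmod c"
proof -
  have "star (c *\<^sub>C 1) * (c *\<^sub>C 1) = of_real ((cmod c)\<^sup>2) *\<^sub>C (1 :: 'i bop)"
    by (simp add: star_scaleC star_one mult_scaleC_left mult_scaleC_right scaleC_scaleC
        complex_norm_square mult.commute del: of_real_power)
  hence "(norm (c *\<^sub>C (1 :: 'i bop)))\<^sup>2 = (cmod c)\<^sup>2"
    unfolding norm_star_mult_self[symmetric] by (simp only: scaleC_of_real_bop) simp
  thus ?thesis by (simp add: power2_eq_iff_nonneg)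
qed

text \<open>Multiplication of the unit by scalars is isometric, so a convergent sequence of scalar
  operators has Cauchy coefficients, and completeness of the complex numbers provides the
  limit.\<close>

lemma closed_scalars: "closed (range (\<lambda>c. c *\<^sub>C (1 :: 'i bop)))"
proof -
  have lin: "bounded_linear (\<lambda>c. c *\<^sub>C (1 :: 'i bop))"
  proof (rule bounded_linear_intro[where K = 1])
    show "(r *\<^sub>R c) *\<^sub>C 1 = r *\<^sub>R c *\<^sub>C (1 :: 'i bop)" for r c
      by (metis scaleC_of_real_bop scaleC_scaleC scaleR_conv_of_real)
  qed (simp_all add: scaleC_add_left norm_scaleC_one)
  show ?thesis
  proof (rule closed_sequential_limits[THEN iffD2, rule_format])
    fix f :: "nat \<Rightarrow> 'i bop" and l
    assume *: "(\<forall>n. f n \<in> range (\<lambda>c. c *\<^sub>C 1)) \<and> f \<longlonglongrightarrow> l"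
    hence f: "f \<longlonglongrightarrow> l" ..
    from * have "\<forall>n. \<exists>c. f n = c *\<^sub>C 1" by auto
    then obtain c where c: "\<And>n. f n = c n *\<^sub>C 1" unfolding choice_iff by blast
    have "dist (c m) (c n) = dist (f m) (f n)" for m n
      using bounded_linear.linear[OF lin, THEN linear_diff, of "c m" "c n"] norm_scaleC_one[where 'i = 'i, of "c m - c n"]
      by (simp add: dist_norm c)
    hence "Cauchy c" using LIMSEQ_imp_Cauchy[OF f] unfolding Cauchy_def by simp
    then obtain z where "c \<longlonglongrightarrow> z" using convergent_eq_Cauchy by blast
    hence "f \<longlonglongrightarrow> z *\<^sub>C 1" unfolding c by (rule bounded_linear.tendsto[OF lin])
    thus "l \<in> range (\<lambda>c. c *\<^sub>C 1)" using LIMSEQ_unique[OF f] by blast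
  qed
qed

lemma star_subalgebra_scalars: "star_subalgebra (range (\<lambda>c. c *\<^sub>C (1 :: 'a::star_algebra_1)))"
  unfolding star_subalgebra_def
  by (auto simp: scaleC_scaleC mult_scaleC_left mult_scaleC_right star_scaleC star_one
      simp flip: scaleC_add_left scaleC_zero_left[of 1])

section \<open>Generated C*-algebras and amplifications\<close>

lemma cstar_generated:
  "star_subalgebra (cstar_generated X)" "closed (cstar_generated X)" "X \<subseteq> cstar_generated X"
proof -
  have "(\<lambda>S. star_subalgebra S \<and> closed S) (cstar_generated X)"
    unfolding cstar_generated_def by (rule hull_in) (auto simp: star_subalgebra_def)
  thus "star_subalgebra (cstar_generated X)" "closed (cstar_generated X)" by auto
  show "X \<subseteq> cstar_generated X" unfolding cstar_generated_def by (rule hull_subset)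
qed

lemma cstar_generated_minimal:
  "X \<subseteq> S \<Longrightarrow> star_subalgebra S \<Longrightarrow> closed S \<Longrightarrow> cstar_generated X \<subseteq> S"
  unfolding cstar_generated_def by (rule hull_minimal) auto

lemma closed_amplification:
  fixes e :: "'k \<Rightarrow> 'k \<Rightarrow> 'i bop"
  assumes "matrix_units I e" "closed S"
  shows "closed (matrix_units.amplification I e S)"
proof -
  interpret matrix_units I e by fact
  have "continuous_on UNIV (coef s t)" for s t
    unfolding coef_def by (intro continuous_intros)
  hence "closed (coef s t -` S)" for s t using closed_vimage[OF assms(2)] by blast
  moreover have "amplification S = (\<Inter>s\<in>I. \<Inter>t\<in>I. coef s t -` S)"
    by (auto simp: amplification_def)
  ultimately show ?thesis by (simp add: closed_INT)
qed

text \<open>The amplification is a closed subalgebra containing the generators; conversely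
  \<open>expand\<close> writes each of its elements as a finite sum of products from the generated
  algebra. This replaces a norm closure by a condition on coefficients.\<close>

lemma cstar_generated_eq_amplification:
  fixes e :: "'k \<Rightarrow> 'k \<Rightarrow> 'i bop"
  assumes mu: "matrix_units I e" and S: "star_subalgebra S" "closed S"
    and X: "X \<subseteq> matrix_units.amplification I e S" and SX: "S \<subseteq> cstar_generated X"
    and e: "\<And>s t. s \<in> I \<Longrightarrow> t \<in> I \<Longrightarrow> e s t \<in> cstar_generated X"
  shows "cstar_generated X = matrix_units.amplification I e S"
proof
  interpret matrix_units I e by fact
  show "cstar_generated X \<subseteq> amplification S"
    using X star_subalgebra_amplification[OF S(1)] closed_amplification[OF mu S(2)]
    by (rule cstar_generated_minimal)
  show "amplification S \<subseteq> cstar_generated X"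
  proof
    fix x assume "x \<in> amplification S"
    hence "(\<Sum>s\<in>I. \<Sum>t\<in>I. e s t * coef s t x) \<in> cstar_generated X"
      using e SX
      by (intro star_subalgebra_sum cstar_generated star_subalgebraD(3)) (auto simp: amplificationD)
    thus "x \<in> cstar_generated X" using expand[of x] by simp
  qed
qed

text \<open>The commutant of the units is a subalgebra stable under \<open>star\<close>, because the
  set of units is, and it is closed by continuity of multiplication.\<close>

lemma cstar_generated_commuting:
  fixes e :: "'k \<Rightarrow> 'k \<Rightarrow> 'i bop"
  assumes "matrix_units I e" "\<And>x. x \<in> X \<Longrightarrow> matrix_units.commuting I e x" "c \<in> cstar_generated X"
  shows "matrix_units.commuting I e c"
proof -
  interpret matrix_units I e by fact
  have "star_subalgebra (Collect commuting)"
    unfolding star_subalgebra_def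
  proof (intro conjI ballI allI)
    fix x y z assume x: "x \<in> Collect commuting" and y: "y \<in> Collect commuting"
    show "x + y \<in> Collect commuting" "z *\<^sub>C x \<in> Collect commuting"
      using x y by (simp_all add: commuting_def algebra_simps mult_scaleC_left mult_scaleC_right)
    show "x * y \<in> Collect commuting"
      using x y unfolding commuting_def mem_Collect_eq by (metis mult.assoc)
    show "star x \<in> Collect commuting"
      using x unfolding commuting_def mem_Collect_eq by (metis star_mult unit_star)
  qed (simp add: commuting_def)
  moreover have "closed (Collect commuting)"
  proof -
    have "Collect commuting = (\<Inter>s\<in>I. \<Inter>t\<in>I. {x. x * e s t = e s t * x})"
      by (auto simp: commuting_def)
    moreover have "closed {x. x * e s t = e s t * x}" for s t
      by (intro closed_Collect_eq continuous_intros)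
    ultimately show ?thesis by (simp add: closed_INT)
  qed
  ultimately have "cstar_generated X \<subseteq> Collect commuting"
    using assms(2) by (intro cstar_generated_minimal) auto
  thus ?thesis using assms(3) by auto
qed

section \<open>Matrix units of the chain\<close>

text \<open>Extensionality makes agreement on \<open>{..<n}\<close> the same as equality, as the
  index of a system of matrix units requires.\<close>

abbreviation configs :: "nat \<Rightarrow> (nat \<Rightarrow> 'q::finite) set" where
  "configs n \<equiv> {..<n} \<rightarrow>\<^sub>E UNIV"

text \<open>The tensor product of the matrix units of the sites \<open>0, ..., n - 1\<close>.
  Arbitrary functions are allowed as indices, so the recursion need not restrict them; only their
  values below \<open>n\<close> matter.\<close>

primrec config_unit :: "nat \<Rightarrow> (nat \<Rightarrow> 'q) \<Rightarrow> (nat \<Rightarrow> 'q) \<Rightarrow> ('q::finite) chain_op" where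
  "config_unit 0 s t = 1"
| "config_unit (Suc n) s t = config_unit n s t * site_unit n (s n) (t n)"

lemma config_unit_cong:
  "(\<And>k. k < n \<Longrightarrow> s k = s' k \<and> t k = t' k) \<Longrightarrow> config_unit n s t = config_unit n s' t'"
  by (induction n) auto

lemma config_unit_commute_site:
  "n \<le> k \<Longrightarrow> site_unit k a b * config_unit n s t = config_unit n s t * site_unit k a b"
proof (induction n)
  case (Suc n)
  hence "site_unit k a b * config_unit n s t = config_unit n s t * site_unit k a b" by simp
  moreover have "site_unit k a b * site_unit n (s n) (t n) = site_unit n (s n) (t n) * site_unit k a b"
    using Suc.prems by (intro site_unit_commute) simp
  ultimately show ?case by (simp add: mult.assoc) (metis mult.assoc)
qed simp

lemma config_unit_mult:
  "config_unit n s t * config_unit n u v = (if \<forall>k<n. t k = u k then config_unit n s v else 0)"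
proof (induction n)
  case (Suc n)
  have "config_unit (Suc n) s t * config_unit (Suc n) u v =
      config_unit n s t * (site_unit n (s n) (t n) * config_unit n u v) * site_unit n (u n) (v n)"
    by (simp add: mult.assoc)
  also have "\<dots> = (config_unit n s t * config_unit n u v) *
      (site_unit n (s n) (t n) * site_unit n (u n) (v n))"
    by (simp add: config_unit_commute_site mult.assoc)
  finally show ?case by (auto simp: Suc.IH site_unit_mult less_Suc_eq)
qed simp

lemma config_unit_star: "star (config_unit n s t) = config_unit n t s"
  by (induction n) (simp_all add: star_one star_mult star_site_unit config_unit_commute_site)

lemma site_unit_sum: "(\<Sum>a\<in>UNIV. site_unit k a a) = (1 :: ('q::finite) chain_op)"
proof -
  have "(\<Sum>a\<in>UNIV. site_unit k a a) = immersion k (mat 1 :: complex^'q^'q)"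
    unfolding immersion_def mat_def
    by (intro sum.cong refl) (simp add: if_distrib[of "\<lambda>c. c *\<^sub>C _"] scaleC_one scaleC_zero_left cong: if_cong)
  thus ?thesis by (simp add: immersion_one)
qed

lemma config_unit_sum: "(\<Sum>s\<in>configs n. config_unit n s s) = (1 :: ('q::finite) chain_op)"
proof (induction n)
  case (Suc n)
  let ?g = "\<lambda>(a :: 'q, s :: nat \<Rightarrow> 'q). s(n := a)"
  have upd: "config_unit (Suc n) (s(n := a)) (s(n := a)) = config_unit n s s * site_unit n a a"
    for s :: "nat \<Rightarrow> 'q" and a
  proof -
    have "config_unit n (s(n := a)) (s(n := a)) = config_unit n s s"
      by (rule config_unit_cong) simp
    thus ?thesis by (simp only: config_unit.simps fun_upd_same)
  qed
  have inj: "inj_on ?g (UNIV \<times> configs n)" by (rule inj_combinator) simp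
  have "(\<Sum>s :: nat \<Rightarrow> 'q\<in>configs (Suc n). config_unit (Suc n) s s) =
      (\<Sum>(a, s)\<in>UNIV \<times> configs n. config_unit (Suc n) (s(n := a)) (s(n := a)))"
    unfolding lessThan_Suc PiE_insert_eq
    by (subst sum.reindex[OF inj]) (simp add: case_prod_unfold)
  also have "\<dots> = (\<Sum>(a, s)\<in>UNIV \<times> configs n. config_unit n s s * site_unit n a a)"
    by (simp only: upd)
  also have "\<dots> = (\<Sum>a\<in>UNIV. (\<Sum>s\<in>configs n. config_unit n s s) * site_unit n a a)"
    by (simp add: sum.cartesian_product[symmetric] sum_distrib_right)
  finally show ?case by (simp only: Suc.IH mult_1_left site_unit_sum)
qed simp

text \<open>Two of these systems are used together: the one for \<open>n\<close> covers the sites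
  before \<open>n\<close>, the one for \<open>Suc n\<close> also covers site
  \<open>n\<close>.\<close>

interpretation config: matrix_units "configs n" "config_unit n" for n
proof
  show "finite (configs n)" by (simp add: finite_PiE)
  fix s t u v :: "nat \<Rightarrow> 'a" assume "t \<in> configs n" "u \<in> configs n"
  hence "(\<forall>k<n. t k = u k) \<longleftrightarrow> t = u" by (auto intro: PiE_ext)
  thus "config_unit n s t * config_unit n u v = (if t = u then config_unit n s v else 0)"
    by (simp add: config_unit_mult)
qed (simp_all add: config_unit_star config_unit_sum)

lemma site_unit_mult_config_unit:
  "k < n \<Longrightarrow> site_unit k a b * config_unit n t u =
    (if t k = b then config_unit n (t(k := a)) u else 0)"
proof (induction n)
  case (Suc n)
  show ?case
  proof (cases "k = n")
    case True
    have "config_unit n (t(n := a)) u = config_unit n t u" by (rule config_unit_cong) simp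
    hence upd: "config_unit (Suc n) (t(n := a)) u = config_unit n t u * site_unit n a (u n)"
      by (simp only: config_unit.simps fun_upd_same)
    have prod: "site_unit n a b * config_unit (Suc n) t u =
        config_unit n t u * (site_unit n a b * site_unit n (t n) (u n))"
      by (simp add: config_unit_commute_site flip: mult.assoc)
    show ?thesis unfolding True upd prod site_unit_mult by simp
  next
    case False
    hence IH: "site_unit k a b * config_unit n t u = (if t k = b then config_unit n (t(k := a)) u else 0)"
      using Suc by simp
    have upd: "config_unit (Suc n) (t(k := a)) u = config_unit n (t(k := a)) u * site_unit n (t n) (u n)"
      by (simp only: config_unit.simps fun_upd_other[OF not_sym[OF False]])
    have prod: "site_unit k a b * config_unit (Suc n) t u =
        (if t k = b then config_unit n (t(k := a)) u else 0) * site_unit n (t n) (u n)"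
      by (simp only: config_unit.simps mult.assoc[symmetric] IH)
    show ?thesis unfolding upd prod by simp
  qed
qed simp

text \<open>All entries are 0 or 1, which places the generators at sites before \<open>n\<close>
  among the operators with scalar coefficients.\<close>

lemma coef_site_unit:
  fixes a b :: "'q::finite"
  assumes "k < n" "s \<in> configs n" "t \<in> configs n"
  shows "config.coef n s t (site_unit k a b) = (if t k = b \<and> s = t(k := a) then 1 else 0)"
proof -
  have mem: "t(k := a) \<in> configs n" using assms by (auto simp: PiE_iff extensional_def)
  have "config.coef n s t (site_unit k a b) =
      (\<Sum>u\<in>configs n. if t k = b \<and> s = t(k := a) then config_unit n u u else 0)"
    unfolding config.coef_def using assms mem
    by (intro sum.cong refl) (simp add: mult.assoc site_unit_mult_config_unit config.unit_mult)
  thus ?thesis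
    by (cases "t k = b \<and> s = t(k := a)") (simp_all add: config_unit_sum)
qed

section \<open>The segment algebras as amplifications\<close>

abbreviation scalars :: "('q::finite) chain_op set" where
  "scalars \<equiv> range (\<lambda>c. c *\<^sub>C 1)"

lemma zero_mem_scalars: "0 \<in> scalars"
  by (rule star_subalgebraD(1)[OF star_subalgebra_scalars])

lemma one_mem_scalars: "1 \<in> scalars"
  by (metis scaleC_one rangeI)

lemma site_unit_eq_immersion:
  fixes a b :: "'q::finite"
  shows "site_unit k a b = immersion k (\<chi> i j. if i = a \<and> j = b then 1 else 0)"
proof -
  have "immersion k (\<chi> i j. if i = a \<and> j = b then 1 else 0) =
      (\<Sum>i\<in>UNIV. if i = a then \<Sum>j\<in>UNIV. if j = b then site_unit k i j else 0 else 0)"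
    unfolding immersion_def
    by (intro sum.cong refl)
      (simp add: if_distrib[of "\<lambda>c. c *\<^sub>C _"] scaleC_one scaleC_zero_left cong: if_cong)
  thus ?thesis by simp
qed

lemma site_unit_mem_site_algebra: "site_unit k a b \<in> site_algebra k"
  by (simp add: site_algebra_def site_unit_eq_immersion)

lemma star_subalgebra_site_algebra: "star_subalgebra (site_algebra k)"
proof -
  have "(0 :: 'a chain_op) = immersion k 0"
    by (simp add: immersion_def scaleC_zero_left)
  thus ?thesis
    unfolding star_subalgebra_def site_algebra_def
    by (auto simp: immersion_star simp flip: immersion_add immersion_mult immersion_scaleC)
qed

lemma config_unit_mem:
  assumes "star_subalgebra A" "1 \<in> A" "\<And>k a b. k < n \<Longrightarrow> site_unit k a b \<in> A"
  shows "config_unit n s t \<in> A"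
  using assms(3) by (induction n) (auto simp: assms(2) intro: star_subalgebraD(3)[OF assms(1)])

lemma immersion_mem:
  assumes "star_subalgebra A" "\<And>a b. site_unit k a b \<in> A"
  shows "immersion k x \<in> A"
  unfolding immersion_def
  by (intro star_subalgebra_sum star_subalgebraD(4) assms)

lemma immersion_mem_amplification:
  assumes "k < n"
  shows "immersion k x \<in> config.amplification n scalars"
proof (rule immersion_mem)
  show "star_subalgebra (config.amplification n scalars)"
    by (rule config.star_subalgebra_amplification[OF star_subalgebra_scalars])
  show "site_unit k a b \<in> config.amplification n scalars" for a b :: 'a
    using assms unfolding config.amplification_def
    by (simp add: coef_site_unit zero_mem_scalars one_mem_scalars)
qed

lemma immersion_commuting: "n \<le> k \<Longrightarrow> config.commuting n (immersion k x)"
  unfolding config.commuting_def immersion_def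
  by (simp add: sum_distrib_left sum_distrib_right mult_scaleC_left mult_scaleC_right
      config_unit_commute_site)

lemma segment_algebra_commuting:
  "c \<in> segment_algebra n m \<Longrightarrow> config.commuting n c"
  unfolding segment_algebra_def
  by (rule cstar_generated_commuting[OF config.matrix_units_axioms])
    (auto intro: immersion_commuting)

lemma site_algebra_commuting: "c \<in> site_algebra n \<Longrightarrow> config.commuting n c"
  by (auto simp: site_algebra_def intro: immersion_commuting)

lemma segment_algebra:
  "star_subalgebra (segment_algebra m n)" "closed (segment_algebra m n)"
  "m \<le> k \<Longrightarrow> k \<le> n \<Longrightarrow> immersion k x \<in> segment_algebra m n"
  unfolding segment_algebra_def using cstar_generated(3)
  by (auto intro!: cstar_generated subsetD[OF cstar_generated(3)])

lemma one_mem_segment_algebra: "m \<le> n \<Longrightarrow> 1 \<in> segment_algebra m n"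
  using segment_algebra(3)[of m m n "mat 1"] by (simp add: immersion_one)

lemma scalars_subset: "star_subalgebra A \<Longrightarrow> 1 \<in> A \<Longrightarrow> scalars \<subseteq> A"
  by (auto intro: star_subalgebraD(4))

lemma segment_algebra_mono: "m' \<le> m \<Longrightarrow> n \<le> n' \<Longrightarrow> segment_algebra m n \<subseteq> segment_algebra m' n'"
  unfolding segment_algebra_def cstar_generated_def by (rule hull_mono) fastforce

lemma config_unit_mem_segment_algebra: "n \<le> Suc m \<Longrightarrow> config_unit n s t \<in> segment_algebra 0 m"
  by (rule config_unit_mem[OF segment_algebra(1) one_mem_segment_algebra])
    (auto simp: site_unit_eq_immersion intro!: segment_algebra(3))

text \<open>For \<open>n = 0\<close> there is a single configuration with unit 1, so coefficients
  change nothing and the scalars remain. For \<open>n > 0\<close> the generators have scalar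
  coefficients.\<close>

lemma past_algebra_eq: "past_algebra n = (config.amplification n scalars :: ('q::finite) chain_op set)"
proof (cases n)
  case 0
  have coef: "config.coef 0 s t x = x" for s t and x :: "'q chain_op"
    unfolding config.coef_def by simp
  have "config.amplification 0 scalars = (scalars :: 'q chain_op set)"
    unfolding config.amplification_def coef by simp
  thus ?thesis unfolding 0 past_algebra_def by (simp only: refl if_True)
next
  case (Suc m)
  have "segment_algebra 0 m = (config.amplification n scalars :: 'q chain_op set)"
    unfolding segment_algebra_def
  proof (rule cstar_generated_eq_amplification[OF config.matrix_units_axioms star_subalgebra_scalars closed_scalars])
    show "(\<Union>k\<in>{0..m}. range (immersion k)) \<subseteq> (config.amplification n scalars :: 'q chain_op set)"
      using Suc by (auto intro: immersion_mem_amplification)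
  qed (use Suc config_unit_mem_segment_algebra[of n m] scalars_subset[OF segment_algebra(1) one_mem_segment_algebra, of 0 m]
      in \<open>simp_all add: segment_algebra_def\<close>)
  thus ?thesis using Suc by (simp add: past_algebra_def initial_algebra_def)
qed

text \<open>With the shift by one, the codomain consists of scalar matrices over the units of the
  sites \<open>0, ..., n\<close>; this is the description to which the Gram factorization
  applies.\<close>

lemma initial_algebra_eq_past: "initial_algebra n = past_algebra (Suc n)"
  by (simp add: past_algebra_def)

text \<open>Generators before \<open>n\<close> have scalar coefficients, which lie in the segment
  algebra. Generators at \<open>n\<close> and \<open>n + 1\<close> commute with the units, so their
  coefficient matrix is diagonal with the generator itself as entry.\<close>

lemma initial_algebra_eq:
  "initial_algebra (Suc n) =
    (config.amplification n (segment_algebra n (Suc n)) :: ('q::finite) chain_op set)"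
proof -
  let ?S = "segment_algebra n (Suc n) :: 'q chain_op set"
  have sub: "scalars \<subseteq> ?S"
    by (rule scalars_subset[OF segment_algebra(1) one_mem_segment_algebra]) simp
  have "immersion k x \<in> config.amplification n ?S" if "k \<le> Suc n" for k x
  proof (cases "k < n")
    case True
    thus ?thesis
      using immersion_mem_amplification[OF True, of x] sub
      unfolding config.amplification_def by blast
  next
    case False
    have "immersion k x \<in> ?S" "config.commuting n (immersion k x)"
      using that False by (auto intro: segment_algebra(3) immersion_commuting)
    thus ?thesis
      by (simp add: config.amplification_def config.coef_commuting star_subalgebraD(1)[OF segment_algebra(1)])
  qed
  hence "(\<Union>k\<in>{0..Suc n}. range (immersion k)) \<subseteq> config.amplification n ?S" by auto
  moreover have "?S \<subseteq> segment_algebra 0 (Suc n)" by (rule segment_algebra_mono) auto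
  ultimately show ?thesis
    unfolding initial_algebra_def segment_algebra_def[of 0]
    by (intro cstar_generated_eq_amplification[OF config.matrix_units_axioms] segment_algebra)
      (auto simp flip: segment_algebra_def intro: config_unit_mem_segment_algebra)
qed

lemma site_algebra_subset: "site_algebra n \<subseteq> initial_algebra n"
  by (auto simp: site_algebra_def initial_algebra_def intro: segment_algebra(3))

lemma algebra_triplet:
  "star_algebra_triplet (past_algebra n) (initial_algebra n) (initial_algebra (n + 1))"
proof -
  have "past_algebra n \<subseteq> initial_algebra n"
    using scalars_subset[OF segment_algebra(1) one_mem_segment_algebra, of 0 0]
    by (auto simp: past_algebra_def initial_algebra_def intro: subsetD[OF segment_algebra_mono, rotated 2])
  moreover have "1 \<in> past_algebra n"
    by (simp add: past_algebra_def initial_algebra_def one_mem_scalars one_mem_segment_algebra)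
  moreover have "initial_algebra n \<subseteq> initial_algebra (n + 1)"
    unfolding initial_algebra_def by (rule segment_algebra_mono) auto
  moreover have "star_subalgebra (past_algebra n)"
    unfolding past_algebra_eq by (rule config.star_subalgebra_amplification[OF star_subalgebra_scalars])
  ultimately show ?thesis
    unfolding star_algebra_triplet_def by (simp add: initial_algebra_def segment_algebra)
qed

section \<open>Units of the sites up to n, seen from the sites before n\<close>

lemma restrict_mem_configs: "restrict s {..<n} \<in> configs n"
  by auto

lemma config_unit_restrict: "config_unit n (restrict s {..<n}) (restrict t {..<n}) = config_unit n s t"
  by (rule config_unit_cong) simp

lemma coef_config_unit_Suc:
  assumes "p \<in> configs n" "q \<in> configs n"
  shows "config.coef n p q (config_unit (Suc n) s t) =
    (if restrict s {..<n} = p \<and> restrict t {..<n} = q then site_unit n (s n) (t n) else 0)"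
  unfolding config_unit.simps config_unit_restrict[of n s t, symmetric]
  by (rule config.coef_unit_mult[OF assms restrict_mem_configs restrict_mem_configs])
    (rule site_algebra_commuting[OF site_unit_mem_site_algebra])

text \<open>Entries of elements of the codomain are thereby admissible as the elements
  \<open>b j\<close> in the complete positivity of \<open>E\<close>.\<close>

lemma coef_mem_site_algebra:
  assumes "x \<in> initial_algebra n" "p \<in> configs n" "q \<in> configs n"
  shows "config.coef n p q x \<in> site_algebra n"
proof -
  note alg = star_subalgebraD[OF star_subalgebra_site_algebra]
  obtain z where z: "x = (\<Sum>s\<in>configs (Suc n). \<Sum>t\<in>configs (Suc n). z s t *\<^sub>C config_unit (Suc n) s t)"
    using assms(1) unfolding initial_algebra_eq_past past_algebra_eq
    by (rule config.amplification_scalarsE) blast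
  show ?thesis
    unfolding z config.coef_sum config.coef_scaleC coef_config_unit_Suc[OF assms(2,3)]
    by (intro star_subalgebra_sum star_subalgebra_site_algebra alg(4))
      (simp add: alg site_unit_mem_site_algebra)
qed

text \<open>If one diagonal unit vanished, all would, since each is a product containing it; but
  they sum to 1.\<close>

lemma site_unit_nonzero:
  fixes a :: "'q::finite"
  shows "site_unit k a a \<noteq> 0"
proof
  assume zero: "site_unit k a a = 0"
  have "site_unit k b b = site_unit k b a * site_unit k a a * site_unit k a b" for b :: 'q
    by (simp add: site_unit_mult)
  hence "site_unit k b b = 0" for b :: 'q unfolding zero by simp
  thus False using site_unit_sum[where 'q = 'q, of k] by simp
qed

section \<open>The extended expectation\<close>

locale local_expectation =
  fixes n :: nat and E :: "('q::finite) chain_op \<Rightarrow> 'q chain_op"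
  assumes E: "completely_positive (segment_algebra n (n + 1)) (site_algebra n) E"
begin

sublocale matrix_units_extension "configs n" "config_unit n" "segment_algebra n (n + 1)" "site_algebra n" E
proof
  show "1 \<in> site_algebra n" unfolding site_algebra_def by (metis immersion_one rangeI)
qed (use E in \<open>simp_all add: segment_algebra one_mem_segment_algebra segment_algebra_commuting site_algebra_commuting\<close>)

lemma ext_mem:
  assumes "x \<in> initial_algebra (n + 1)"
  shows "ext x \<in> initial_algebra n"
proof -
  have "x \<in> config.amplification n (segment_algebra n (n + 1))"
    using assms by (simp add: initial_algebra_eq)
  hence "E (config.coef n s t x) \<in> site_algebra n" if "s \<in> configs n" "t \<in> configs n" for s t
    using that by (intro clinear_mapD(1)[OF linear] config.amplificationD)
  hence "E (config.coef n s t x) \<in> initial_algebra n" if "s \<in> configs n" "t \<in> configs n" for s t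
    using that site_algebra_subset by blast
  moreover have "config_unit n s t \<in> initial_algebra n" for s t :: "nat \<Rightarrow> 'q"
    unfolding initial_algebra_def by (rule config_unit_mem_segment_algebra) simp
  moreover have "star_subalgebra (initial_algebra n)"
    unfolding initial_algebra_def by (rule segment_algebra)
  ultimately show ?thesis
    unfolding ext_def by (intro star_subalgebra_sum star_subalgebraD(3)) auto
qed

lemma ext_completely_positive:
  "completely_positive (initial_algebra (n + 1)) (initial_algebra n) ext"
  unfolding completely_positive_def
proof (intro conjI allI impI)
  let ?B = "initial_algebra n :: 'q chain_op set" and ?D = "initial_algebra (n + 1) :: 'q chain_op set"
  show "clinear_map ?D ?B ext"
    unfolding clinear_map_def using ext_mem by (auto simp: initial_algebra_eq ext_add ext_scaleC)
  fix m :: nat and b d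
  assume bd: "\<forall>j<m. b j \<in> ?B \<and> d j \<in> ?D"
  have B: "star_subalgebra ?B" and D: "star_subalgebra ?D"
    by (simp_all add: initial_algebra_def segment_algebra)
  \<comment> \<open>Kept as a function of the family, so that it can also be evaluated at
    \<open>b j * c\<close>.\<close>
  define form where "form b = (\<Sum>j<m. \<Sum>k<m. star (b j) * ext (star (d j) * d k) * b k)" for b
  have "star (d j) * d k \<in> ?D" if "j < m" "k < m" for j k
    using bd that by (intro star_subalgebraD(3)[OF D] star_subalgebraD(5)[OF D]) auto
  hence "form b \<in> ?B"
    unfolding form_def using bd
    by (intro star_subalgebra_sum B star_subalgebraD(3)[OF B] star_subalgebraD(5)[OF B] ext_mem) auto
  then obtain x where
    x: "\<And>s t. s \<in> configs (Suc n) \<Longrightarrow> t \<in> configs (Suc n) \<Longrightarrow>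
      config.coef (Suc n) s t (form b) = x s t *\<^sub>C 1"
    and form: "form b = (\<Sum>s\<in>configs (Suc n). \<Sum>t\<in>configs (Suc n). x s t *\<^sub>C config_unit (Suc n) s t)"
    unfolding initial_algebra_eq_past past_algebra_eq
    by (rule config.amplification_scalarsE) blast
  have "psd_on (configs (Suc n)) x"
    unfolding psd_on_def
  proof
    fix \<xi>
    let ?Q = "\<Sum>s\<in>configs (Suc n). \<Sum>t\<in>configs (Suc n). cnj (\<xi> s) * x s t * \<xi> t"
    obtain p :: "nat \<Rightarrow> 'q" where p: "p \<in> configs (Suc n)"
      using config.index_nonempty by blast
    \<comment> \<open>The part of \<open>p\<close> before site \<open>n\<close>:
      \<open>config_unit (Suc n) p p\<close> has \<open>site_unit n (p n) (p n)\<close> as its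
      coefficient at \<open>q\<close>, \<open>q\<close>.\<close>
    define q where "q = restrict p {..<n}"
    have q: "q \<in> configs n" unfolding q_def by (rule restrict_mem_configs)
    define c where "c = (\<Sum>t\<in>configs (Suc n). \<xi> t *\<^sub>C config_unit (Suc n) t p)"
    have cB: "c \<in> ?B"
      unfolding c_def initial_algebra_eq_past past_algebra_eq
      by (intro star_subalgebra_sum star_subalgebraD(4) config.unit_mem_amplification_scalars
          config.star_subalgebra_amplification star_subalgebra_scalars p)
    have "form (\<lambda>j. b j * c) = star c * form b * c"
      by (simp add: form_def star_mult sum_distrib_left sum_distrib_right mult.assoc)
    also have "\<dots> = ?Q *\<^sub>C config_unit (Suc n) p p"
      unfolding c_def by (rule config.quadratic_form_unit[OF x p])
    finally have "config.coef n q q (form (\<lambda>j. b j * c)) = ?Q *\<^sub>C site_unit n (p n) (p n)"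
      using q by (simp only: config.coef_scaleC coef_config_unit_Suc q_def) simp
    moreover obtain Z :: "(nat \<Rightarrow> 'q) \<Rightarrow> 'q chain_op" where
      "\<forall>s\<in>configs n. positive_in (site_algebra n) (Z s)"
      "config.coef n q q (form (\<lambda>j. b j * c)) = (\<Sum>s\<in>configs n. Z s)"
      unfolding form_def
      by (rule exE[OF coef_ext_form_positive[where K = "{..<m}" and b = "\<lambda>j. b j * c" and d = d and q = q]])
        (use q bd cB in \<open>auto intro!: coef_mem_site_algebra star_subalgebraD(3)[OF B] simp flip: initial_algebra_eq\<close>)
    ultimately have "nonneg_op (?Q *\<^sub>C site_unit n (p n) (p n))"
      by (metis (no_types, lifting) nonneg_op_sum positive_in_nonneg_op)
    \<comment> \<open>The diagonal unit is a projection and thus a square, the shape that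
      \<open>nonneg_op_scaleC_square\<close> expects.\<close>
    hence "nonneg_op (?Q *\<^sub>C (star (site_unit n (p n) (p n)) * site_unit n (p n) (p n)))"
      by (simp only: star_site_unit site_unit_mult refl if_True)
    thus "?Q \<in> \<real>\<^sub>\<ge>\<^sub>0"
      by (rule nonneg_op_scaleC_square) (rule site_unit_nonzero)
  qed
  moreover have "config_unit (Suc n) s t \<in> ?B" for s t
    unfolding initial_algebra_def by (rule config_unit_mem_segment_algebra) simp
  ultimately have "positive_in ?B (form b)"
    unfolding form by (intro config.psd_positive_in B)
  thus "positive_in ?B (\<Sum>j<m. \<Sum>k<m. star (b j) * ext (star (d j) * d k) * b k)"
    by (simp add: form_def)
qed

text \<open>Normalization is left out so that both cases of the theorem share one argument. Since
  functions are total, uniqueness is expressed by fixing the value off the domain through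
  \<open>extensional\<close>.\<close>

abbreviation is_extension :: "('q chain_op \<Rightarrow> 'q chain_op) \<Rightarrow> bool" where
  "is_extension F \<equiv> F \<in> extensional (initial_algebra (n + 1)) \<and>
    quasi_cond_exp_axioms (past_algebra n) (initial_algebra n) (initial_algebra (n + 1)) F \<and>
    (\<forall>a\<in>past_algebra n. \<forall>b\<in>segment_algebra n (n + 1). F (a * b) = a * E b)"

lemma extension_unique:
  assumes "is_extension F"
  shows "F = restrict ext (initial_algebra (n + 1))"
proof (rule extensionalityI)
  show "F \<in> extensional (initial_algebra (n + 1))" using assms by blast
  fix x :: "'q chain_op" assume x: "x \<in> initial_algebra (n + 1)"
  have "clinear_map (config.amplification n (segment_algebra n (n + 1))) (initial_algebra n) F"
    using assms by (auto simp: quasi_cond_exp_axioms_def initial_algebra_eq dest: completely_positive_clinear)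
  \<comment> \<open>The units are themselves admissible left factors \<open>a\<close>, so the
    prescribed values determine \<open>F\<close> on all products
    \<open>config_unit n s t * b\<close>.\<close>
  moreover have "config_unit n s t \<in> past_algebra n" if "s \<in> configs n" "t \<in> configs n" for s t :: "nat \<Rightarrow> 'q"
    unfolding past_algebra_eq using that by (rule config.unit_mem_amplification_scalars)
  ultimately have "F x = ext x"
    using assms x by (intro ext_unique) (auto simp: initial_algebra_eq)
  thus "F x = restrict ext (initial_algebra (n + 1)) x" using x by simp
qed simp

lemma is_extension_ext: "is_extension (restrict ext (initial_algebra (n + 1)))"
proof (intro conjI ballI)
  let ?C = "past_algebra n :: 'q chain_op set" and ?B = "initial_algebra n :: 'q chain_op set"
    and ?D = "initial_algebra (n + 1) :: 'q chain_op set"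
  note triplet = algebra_triplet[of n, unfolded star_algebra_triplet_def]
  have D: "star_subalgebra ?D" using triplet by blast
  have CD: "c \<in> ?D" if "c \<in> ?C" for c using triplet that by blast
  have module: "restrict ext ?D (c * a) = c * restrict ext ?D a" if "c \<in> ?C" "a \<in> ?D" for c a
    using that ext_module[of c a] star_subalgebraD(3)[OF D CD]
    by (simp add: past_algebra_eq initial_algebra_eq)
  show "quasi_cond_exp_axioms ?C ?B ?D (restrict ext ?D)"
    unfolding quasi_cond_exp_axioms_def
  proof (intro conjI ballI)
    show "completely_positive ?D ?B (restrict ext ?D)"
      using ext_completely_positive D by (rule completely_positive_cong) simp
    fix x assume "x \<in> ?D"
    thus "restrict ext ?D (star x) = star (restrict ext ?D x)"
      using ext_star[of x] star_subalgebraD(5)[OF D] by (simp add: initial_algebra_eq)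
  qed (use module algebra_triplet in auto)
  fix a b :: "'q chain_op"
  assume a: "a \<in> ?C" and b: "b \<in> segment_algebra n (n + 1)"
  have "b \<in> ?D" using amplification_S[OF b] by (simp add: initial_algebra_eq)
  thus "restrict ext ?D (a * b) = a * E b"
    using module[OF a] ext_base[OF b] by simp
qed simp

lemma ex1_extension: "\<exists>!F. is_extension F"
proof (rule ex1I)
  show "is_extension (restrict ext (initial_algebra (n + 1)))" by (rule is_extension_ext)
qed (rule extension_unique)

text \<open>The prescribed formula at \<open>a = b = 1\<close> ties the normalization of
  \<open>F\<close> to that of \<open>E\<close>; this decides which of the two kinds of expectation
  arises.\<close>

lemma is_extension_one:
  assumes "is_extension F"
  shows "F 1 = E 1"
proof -
  have "(1 :: 'q chain_op) \<in> past_algebra n" "(1 :: 'q chain_op) \<in> segment_algebra n (n + 1)"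
    using algebra_triplet[of n] one_S by (auto simp: star_algebra_triplet_def)
  thus ?thesis using assms by (metis mult_1_left)
qed

end

theorem theorem5:
  fixes n :: nat and E :: "('q::finite) chain_op \<Rightarrow> 'q chain_op"
  assumes "completely_positive (segment_algebra n (n + 1)) (site_algebra n) E"
  shows
    "(E 1 = 1 \<longrightarrow>
       (\<exists>!F. F \<in> extensional (initial_algebra (n + 1)) \<and>
         quasi_cond_exp (past_algebra n) (initial_algebra n) (initial_algebra (n + 1)) F \<and>
         (\<forall>a\<in>past_algebra n. \<forall>b\<in>segment_algebra n (n + 1). F (a * b) = a * E b))) \<and>
     (E 1 \<noteq> 1 \<longrightarrow>
       (\<exists>!F. F \<in> extensional (initial_algebra (n + 1)) \<and>
         nonnormalized_quasi_cond_exp (past_algebra n) (initial_algebra n) (initial_algebra (n + 1)) F \<and>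
         (\<forall>a\<in>past_algebra n. \<forall>b\<in>segment_algebra n (n + 1). F (a * b) = a * E b)))"
proof (intro conjI impI)
  interpret local_expectation n E by standard fact
  have normalized: "(F \<in> extensional (initial_algebra (n + 1)) \<and>
      quasi_cond_exp (past_algebra n) (initial_algebra n) (initial_algebra (n + 1)) F \<and>
      (\<forall>a\<in>past_algebra n. \<forall>b\<in>segment_algebra n (n + 1). F (a * b) = a * E b)) \<longleftrightarrow>
      is_extension F" if "E 1 = 1" for F
    using is_extension_one[of F] that unfolding quasi_cond_exp_def by argo
  have nonnormalized: "(F \<in> extensional (initial_algebra (n + 1)) \<and>
      nonnormalized_quasi_cond_exp (past_algebra n) (initial_algebra n) (initial_algebra (n + 1)) F \<and>
      (\<forall>a\<in>past_algebra n. \<forall>b\<in>segment_algebra n (n + 1). F (a * b) = a * E b)) \<longleftrightarrow>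
      is_extension F" if "E 1 \<noteq> 1" for F
    using is_extension_one[of F] that unfolding nonnormalized_quasi_cond_exp_def by argo
  show "\<exists>!F. F \<in> extensional (initial_algebra (n + 1)) \<and>
      quasi_cond_exp (past_algebra n) (initial_algebra n) (initial_algebra (n + 1)) F \<and>
      (\<forall>a\<in>past_algebra n. \<forall>b\<in>segment_algebra n (n + 1). F (a * b) = a * E b)" if "E 1 = 1"
    unfolding normalized[OF that] by (rule ex1_extension)
  show "\<exists>!F. F \<in> extensional (initial_algebra (n + 1)) \<and>
      nonnormalized_quasi_cond_exp (past_algebra n) (initial_algebra n) (initial_algebra (n + 1)) F \<and>
      (\<forall>a\<in>past_algebra n. \<forall>b\<in>segment_algebra n (n + 1). F (a * b) = a * E b)" if "E 1 \<noteq> 1"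
    unfolding nonnormalized[OF that] by (rule ex1_extension)
qed

end
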